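(* Let $\gamma>0$ and $\mu\in\mathcal{OS}\cap\mathcal{ID}$, with associated $\nu_1$. Suppose that, for every $a\ge 0$, $$\liminf_{x\to\infty}\frac{e^{-\gamma a}\overline{\nu_1}(x-a)}{\overline{\nu_1}(x)}\ge 1.$$ Then either $T(\mu,\gamma)=(0,\infty)$ or $T(\mu,\gamma)=\emptyset$.
   Context: "Distribution" means probability distribution on $\mathbb R$; $\bar\xi(x)=\xi((x,\infty))$ is the tail of a measure $\xi$; $\rho^{n*}$ is the $n$-th convolution power. $f\sim g$ means $\lim_{x\to\infty}f(x)/g(x)=1$; $f\asymp g$ means $0<\liminf_{x\to\infty}f(x)/g(x)\le\limsup_{x\to\infty}f(x)/g(x)<\infty$. $\rho\in\mathcal{L}(\gamma)$ if $\bar\rho(x)>0$ for all $x>0$ and $\bar\rho(x+a)\sim e^{-\gamma a}\bar\rho(x)$ for every $a\in\mathbb R$. $\rho\in\mathcal{OS}$ if $\bar\rho(x)>0$ for all $x>0$ and $\overline{\rho^{2*}}(x)\asymp\bar\rho(x)$. $\mathcal{ID}$ is the class of infinitely divisible distributions on $\mathbb R$. For $\mu\in\mathcal{ID}$, $\nu$ denotes its Lévy measure and $\mu^{t*}$ ($t>0$) its $t$-th convolution power (the distribution with characteristic function the $t$-th power of that of $\mu$, i.e. the law at time $t$ of the associated Lévy process). When $\bar\nu(c)>0$ for all $c>0$ (which is the case for $\mu\in\mathcal{OS}\cap\mathcal{ID}$), $\nu_1(dx):=1_{(1,\infty)}(x)\nu(dx)/\bar\nu(1)$. $T(\mu,\gamma):=\{t>0:\mu^{t*}\in\mathcal{L}(\gamma)\}$.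 *)

theory Defs
  imports "HOL-Probability.Probability"
begin

definition tail :: "real measure \<Rightarrow> real \<Rightarrow> real" where
  "tail \<xi> x = measure \<xi> {x<..}"

primrec conv_power :: "real measure \<Rightarrow> nat \<Rightarrow> real measure" where
  "conv_power \<rho> 0 = return borel 0"
| "conv_power \<rho> (Suc n) = convolution \<rho> (conv_power \<rho> n)"

(* For eventually positive functions the middle inequality liminf <= limsup is automatic. *)
definition asymp_comparable :: "(real \<Rightarrow> real) \<Rightarrow> (real \<Rightarrow> real) \<Rightarrow> bool" where
  "asymp_comparable f g \<longleftrightarrow>
     0 < Liminf at_top (\<lambda>x. ereal (f x / g x)) \<and>
     Liminf at_top (\<lambda>x. ereal (f x / g x)) \<le> Limsup at_top (\<lambda>x. ereal (f x / g x)) \<and>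
     Limsup at_top (\<lambda>x. ereal (f x / g x)) < \<infinity>"

definition class_L :: "real \<Rightarrow> real measure set" where
  "class_L \<gamma> = {\<rho>. real_distribution \<rho> \<and> (\<forall>x>0. tail \<rho> x > 0) \<and>
     (\<forall>a. ((\<lambda>x. tail \<rho> (x + a) / (exp (- \<gamma> * a) * tail \<rho> x)) \<longlongrightarrow> 1) at_top)}"

definition class_OS :: "real measure set" where
  "class_OS = {\<rho>. real_distribution \<rho> \<and> (\<forall>x>0. tail \<rho> x > 0) \<and>
     asymp_comparable (tail (conv_power \<rho> 2)) (tail \<rho>)}"

definition class_ID :: "real measure set" where
  "class_ID = {\<mu>. real_distribution \<mu> \<and>
     (\<forall>n\<ge>1. \<exists>\<rho>. real_distribution \<rho> \<and> conv_power \<rho> n = \<mu>)}"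

(* \<nu> is the jump measure in the Levy-Khintchine representation of \<mu>, with Gaussian
   variance A and truncation function x 1_{|x| <= 1}. Another truncation changes only b. *)
definition is_levy_measure :: "real measure \<Rightarrow> real measure \<Rightarrow> bool" where
  "is_levy_measure \<mu> \<nu> \<longleftrightarrow>
     sets \<nu> = sets borel \<and>
     emeasure \<nu> {0} = 0 \<and>
     (\<integral>\<^sup>+ x. ennreal (min 1 (x\<^sup>2)) \<partial>\<nu>) < \<infinity> \<and>
     (\<exists>A\<ge>0. \<exists>b::real. \<forall>z::real.
        char \<mu> z = exp (complex_of_real (- A * z\<^sup>2 / 2) + \<i> * complex_of_real (b * z) +
          (LINT x|\<nu>. iexp (z * x) - 1 - \<i> * complex_of_real (z * x * indicator {-1..1} x))))"

(* The t-th power of the characteristic function is exp (t \<psi>) for its distinguished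
   logarithm \<psi>: the unique continuous logarithm with \<psi> 0 = 0, which exists because the
   characteristic function of an infinitely divisible distribution has no zeros. *)
definition is_conv_rpower :: "real measure \<Rightarrow> real \<Rightarrow> real measure \<Rightarrow> bool" where
  "is_conv_rpower \<mu> t \<rho> \<longleftrightarrow> real_distribution \<rho> \<and>
     (\<exists>\<psi>::real \<Rightarrow> complex. continuous_on UNIV \<psi> \<and> \<psi> 0 = 0 \<and>
        (\<forall>z. char \<mu> z = exp (\<psi> z)) \<and>
        (\<forall>z. char \<rho> z = exp (complex_of_real t * \<psi> z)))"

definition conv_rpower :: "real measure \<Rightarrow> real \<Rightarrow> real measure" where
  "conv_rpower \<mu> t = (THE \<rho>. is_conv_rpower \<mu> t \<rho>)"

(* uniform_measure is the normalised restriction 1_{(1,\<infinity>)} \<nu>(dx) / \<nu>((1,\<infinity>)). *)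
definition levy_tail_measure :: "real measure \<Rightarrow> real measure" where
  "levy_tail_measure \<nu> = uniform_measure \<nu> {1<..}"

definition T_set :: "real measure \<Rightarrow> real \<Rightarrow> real set" where
  "T_set \<mu> \<gamma> = {t. t > 0 \<and> conv_rpower \<mu> t \<in> class_L \<gamma>}"

end

(* Write mu^t for the convolution powers, m for the tail of mu, and call a law rho with tail O(m)
   decreasing if exp(gamma x) tail rho (x) is nonincreasing up to errors exp(gamma x) o(m(x)), and
   increasing if the reverse holds. The law mu^t is CP_t * Z_t, where CP_t is compound Poisson with
   jump law nu_1 and Z_t has all positive exponential moments. The hypothesis says that nu_1 is
   decreasing. This property passes to convolutions, to the Poisson series and to Z_t, hence every
   mu^t is decreasing. If some mu^t is in L(gamma), it is also increasing; for s < t the factor mu^s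
   of mu^t = mu^s * mu^(t-s) must then be increasing too, since its drift is nonnegative up to
   o(m) and averages to o(m). Convolution powers extend this to all times. As the tail of each mu^t
   is comparable to m, being both decreasing and increasing means being in L(gamma). *)

theory Submission
  imports Defs
begin

subsection \<open>Convolutions and their tails\<close>

text \<open>Every comparison rests on one consequence of OS: m(1) m(x-1) <= K m(x), so m decays at
  most exponentially. Hence bounded shifts cost constants, and laws with all positive exponential
  moments have tail o(m). The two directions behave differently under convolution. Comparing the
  tails at x - a and x leaves a boundary strip of width a; it helps an upper bound on the increments
  but hurts a lower bound, and its mass may be of order m(x). Therefore the cut is chosen, for each
  x, among many disjoint strips so as to hit one of small mass. Passing an increase to a factor
  meets a similar obstacle: an average of increments over the other factor controls no single
  increment. Almost monotonicity, made uniform in the step length, turns a longer step seen from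
  every point of a bounded window into one fixed step. At small times the tail might be far smaller
  than m; comparing Poisson weights term by term, with a geometric remainder absorbed on the left,
  excludes this.\<close>

lemma real_distribution_convolution:
  assumes "real_distribution \<rho>" "real_distribution \<sigma>"
  shows "real_distribution (\<rho> \<star> \<sigma>)"
proof -
  interpret R: real_distribution \<rho> by fact
  interpret S: real_distribution \<sigma> by fact
  interpret RS: pair_prob_space \<rho> \<sigma> ..
  show ?thesis
    unfolding convolution_def
    by (intro RS.real_distribution_distr) simp
qed

lemma real_distribution_return_borel: "real_distribution (return borel (x::real))"
  by (simp add: real_distribution_def real_distribution_axioms_def prob_space_return)

lemma real_distribution_conv_power:
  assumes "real_distribution \<rho>"
  shows "real_distribution (conv_power \<rho> n)"
  by (induction n) (auto simp: assms real_distribution_return_borel real_distribution_convolution)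

lemma integral_convolution:
  fixes f :: "real \<Rightarrow> 'b::{banach, second_countable_topology}"
  assumes "real_distribution \<rho>" "real_distribution \<sigma>"
    and f [measurable]: "f \<in> borel_measurable borel" and B: "\<And>x. norm (f x) \<le> B"
  shows "(LINT x|(\<rho> \<star> \<sigma>). f x) = (LINT y|\<sigma>. LINT x|\<rho>. f (x + y))"
    and "(LINT x|(\<rho> \<star> \<sigma>). f x) = (LINT x|\<rho>. LINT y|\<sigma>. f (x + y))"
proof -
  interpret R: real_distribution \<rho> by fact
  interpret S: real_distribution \<sigma> by fact
  interpret RS: pair_prob_space \<rho> \<sigma> ..
  have int: "integrable (\<rho> \<Otimes>\<^sub>M \<sigma>) (\<lambda>(x, y). f (x + y))"
    by (rule RS.integrable_const_bound[where B=B]) (auto simp: B split: prod.splits)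
  have eq: "(LINT x|(\<rho> \<star> \<sigma>). f x) = (LINT p|(\<rho> \<Otimes>\<^sub>M \<sigma>). f (fst p + snd p))"
    unfolding convolution_def by (subst integral_distr) (auto simp: split_beta)
  show "(LINT x|(\<rho> \<star> \<sigma>). f x) = (LINT x|\<rho>. LINT y|\<sigma>. f (x + y))"
    using RS.integral_fst'[OF int[unfolded split_beta]] by (simp add: eq)
  show "(LINT x|(\<rho> \<star> \<sigma>). f x) = (LINT y|\<sigma>. LINT x|\<rho>. f (x + y))"
    using RS.integral_snd[OF int] by (simp add: eq case_prod_unfold)
qed

lemma char_convolution:
  assumes "real_distribution \<rho>" "real_distribution \<sigma>"
  shows "char (\<rho> \<star> \<sigma>) z = char \<rho> z * char \<sigma> z"
proof -
  have "char (\<rho> \<star> \<sigma>) z = (LINT y|\<sigma>. LINT x|\<rho>. iexp (z * (x + y)))"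
    unfolding char_def
    by (rule integral_convolution(1)[OF assms, where B=1]) auto
  also have "\<dots> = (LINT y|\<sigma>. char \<rho> z * iexp (z * y))"
    unfolding char_def
    by (intro Bochner_Integration.integral_cong refl)
       (simp add: ring_distribs exp_add mult.commute flip: integral_mult_left_zero)
  also have "\<dots> = char \<rho> z * char \<sigma> z"
    by (simp add: char_def)
  finally show ?thesis .
qed

lemma char_return_borel: "char (return borel (0::real)) z = 1"
  unfolding char_def by (subst integral_return) auto

lemma char_conv_power:
  assumes "real_distribution \<rho>"
  shows "char (conv_power \<rho> n) z = char \<rho> z ^ n"
  by (induction n)
     (auto simp: char_return_borel char_convolution assms real_distribution_conv_power)

lemma nn_integral_exp_convolution:
  assumes "real_distribution \<rho>" "real_distribution \<sigma>"
  shows "(\<integral>\<^sup>+x. ennreal (exp (c * x)) \<partial>(\<rho> \<star> \<sigma>)) =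
    (\<integral>\<^sup>+x. ennreal (exp (c * x)) \<partial>\<rho>) * (\<integral>\<^sup>+x. ennreal (exp (c * x)) \<partial>\<sigma>)"
proof -
  interpret R: real_distribution \<rho> by fact
  interpret S: real_distribution \<sigma> by fact
  have "(\<integral>\<^sup>+x. ennreal (exp (c * x)) \<partial>(\<rho> \<star> \<sigma>)) =
    (\<integral>\<^sup>+x. \<integral>\<^sup>+y. ennreal (exp (c * (x + y))) \<partial>\<sigma> \<partial>\<rho>)"
    by (rule nn_integral_convolution) (auto simp: R.finite_measure_axioms S.finite_measure_axioms)
  also have "\<dots> = (\<integral>\<^sup>+x. ennreal (exp (c * x)) * (\<integral>\<^sup>+y. ennreal (exp (c * y)) \<partial>\<sigma>) \<partial>\<rho>)"
    by (simp add: ring_distribs exp_add ennreal_mult nn_integral_cmult)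
  also have "\<dots> = (\<integral>\<^sup>+x. ennreal (exp (c * x)) \<partial>\<rho>) * (\<integral>\<^sup>+x. ennreal (exp (c * x)) \<partial>\<sigma>)"
    by (simp add: nn_integral_multc)
  finally show ?thesis .
qed

lemma nn_integral_exp_conv_power:
  assumes "real_distribution \<rho>"
  shows "(\<integral>\<^sup>+x. ennreal (exp (c * x)) \<partial>(conv_power \<rho> n)) =
    (\<integral>\<^sup>+x. ennreal (exp (c * x)) \<partial>\<rho>) ^ n"
  by (induction n)
     (auto simp: nn_integral_return nn_integral_exp_convolution assms real_distribution_conv_power)

lemma convolution_commute_real:
  assumes "real_distribution \<rho>" "real_distribution \<sigma>"
  shows "(\<rho> \<star> \<sigma>) = (\<sigma> \<star> \<rho>)"
  by (rule Levy_uniqueness)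
     (auto simp: assms real_distribution_convolution char_convolution mult.commute)

lemma tail_bounds:
  assumes "real_distribution \<rho>"
  shows "0 \<le> tail \<rho> x" "tail \<rho> x \<le> 1"
proof -
  interpret R: real_distribution \<rho> by fact
  show "0 \<le> tail \<rho> x" "tail \<rho> x \<le> 1" by (auto simp: tail_def)
qed

lemma tail_antimono:
  assumes "real_distribution \<rho>" "x \<le> y"
  shows "tail \<rho> y \<le> tail \<rho> x"
proof -
  interpret R: real_distribution \<rho> by fact
  show ?thesis unfolding tail_def by (rule R.finite_measure_mono) (use assms in auto)
qed

lemma tail_eq_integral:
  assumes "real_distribution \<rho>"
  shows "tail \<rho> x = (LINT y|\<rho>. indicator {x<..} y)"
proof -
  interpret R: real_distribution \<rho> by fact
  show ?thesis by (simp add: tail_def)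
qed

lemma borel_measurable_tail [measurable]:
  assumes "real_distribution \<rho>"
  shows "tail \<rho> \<in> borel_measurable borel"
proof -
  have "(\<lambda>x. - tail \<rho> x) \<in> borel_measurable borel"
    by (rule borel_measurable_mono) (auto simp: mono_def tail_antimono[OF assms])
  then show ?thesis by simp
qed

lemma tail_to_1_at_bot:
  assumes "real_distribution \<rho>"
  shows "(tail \<rho> \<longlongrightarrow> 1) at_bot"
proof -
  interpret R: real_distribution \<rho> by fact
  have "tail \<rho> x = 1 - cdf \<rho> x" for x
  proof -
    have "{x<..} = space \<rho> - {..x}" by auto
    then show ?thesis unfolding tail_def cdf_def by (simp add: R.prob_compl del: R.space_eq_univ)
  qed
  then have "tail \<rho> = (\<lambda>x. 1 - cdf \<rho> x)" by auto
  then show ?thesis using tendsto_diff[OF tendsto_const[of 1] R.cdf_lim_at_bot] by simp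
qed

lemma ex_tail_pos:
  assumes "real_distribution \<rho>"
  obtains c where "c > 0" "tail \<rho> (- c) > 0"
proof -
  have "eventually (\<lambda>x. tail \<rho> x > 0) at_bot"
    using order_tendstoD(1)[OF tail_to_1_at_bot[OF assms], of 0] by simp
  then obtain b where "\<And>x. x \<le> b \<Longrightarrow> tail \<rho> x > 0" by (auto simp: eventually_at_bot_linorder)
  then have "tail \<rho> (- max 1 (-b)) > 0" by auto
  then show ?thesis using that[of "max 1 (-b)"] by auto
qed

lemma tail_convolution:
  assumes "real_distribution \<rho>" "real_distribution \<sigma>"
  shows "tail (\<rho> \<star> \<sigma>) x = (LINT y|\<sigma>. tail \<rho> (x - y))"
proof -
  have "tail (\<rho> \<star> \<sigma>) x = (LINT y|\<sigma>. LINT z|\<rho>. indicator {x<..} (z + y))"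
    unfolding tail_eq_integral[OF real_distribution_convolution[OF assms]]
    by (rule integral_convolution(1)[OF assms, where B=1]) (auto split: split_indicator)
  also have "\<dots> = (LINT y|\<sigma>. tail \<rho> (x - y))"
    unfolding tail_eq_integral[OF assms(1)]
    by (intro Bochner_Integration.integral_cong refl) (auto split: split_indicator)
  finally show ?thesis .
qed

text \<open>Split by the second summand \<open>y\<close>, the first being \<open>z\<close>: either
  \<open>y <= x - M\<close>, or \<open>y > x - M\<close> and \<open>z <= M\<close>, or both
  thresholds are exceeded. In the last case the sum exceeds \<open>x\<close> automatically, so
  independence gives a product. The freedom in \<open>M\<close> later serves to match the cuts at
  \<open>x\<close> and \<open>x - a\<close>.\<close>

lemma tail_convolution_split:
  assumes "real_distribution \<rho>" "real_distribution \<sigma>"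
  shows "tail (\<rho> \<star> \<sigma>) x =
    (LINT y|\<sigma>. indicator {..x - M} y * tail \<rho> (x - y)) +
    (LINT z|\<rho>. indicator {..M} z * tail \<sigma> (x - z)) + tail \<rho> M * tail \<sigma> (x - M)"
proof -
  interpret R: real_distribution \<rho> by fact
  interpret S: real_distribution \<sigma> by fact
  interpret RS: pair_prob_space \<rho> \<sigma> ..
  note [measurable] = borel_measurable_tail[OF assms(1)] borel_measurable_tail[OF assms(2)]
  have i1: "integrable \<sigma> (\<lambda>y. indicator {..x - M} y * tail \<rho> (x - y))"
    by (rule S.integrable_const_bound[where B=1])
       (auto split: split_indicator simp: tail_bounds[OF assms(1)])
  have i2: "integrable \<sigma> (\<lambda>y. indicator {x - M<..} y * tail \<rho> (x - y))"
    by (rule S.integrable_const_bound[where B=1])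
       (auto split: split_indicator simp: tail_bounds[OF assms(1)])
  have i3: "integrable \<rho> (\<lambda>z. indicator {..M} z * tail \<sigma> (x - z))"
    by (rule R.integrable_const_bound[where B=1])
       (auto split: split_indicator simp: tail_bounds[OF assms(2)])
  have i4: "integrable \<rho> (\<lambda>z. indicator {M<..} z * tail \<sigma> (x - M))"
    by (rule R.integrable_const_bound[where B=1])
       (auto split: split_indicator simp: tail_bounds[OF assms(2)])
  let ?f = "\<lambda>z y. indicator {x - M<..} y * indicator {x<..} (z + y) :: real"
  have int: "integrable (\<rho> \<Otimes>\<^sub>M \<sigma>) (\<lambda>(z, y). ?f z y)"
    by (rule RS.integrable_const_bound[where B=1]) (auto split: split_indicator)
  have "tail (\<rho> \<star> \<sigma>) x = (LINT y|\<sigma>. indicator {..x - M} y * tail \<rho> (x - y) +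
      indicator {x - M<..} y * tail \<rho> (x - y))"
    unfolding tail_convolution[OF assms]
    by (intro Bochner_Integration.integral_cong refl) (auto split: split_indicator)
  also have "\<dots> = (LINT y|\<sigma>. indicator {..x - M} y * tail \<rho> (x - y)) +
      (LINT y|\<sigma>. indicator {x - M<..} y * tail \<rho> (x - y))"
    by (rule Bochner_Integration.integral_add[OF i1 i2])
  also have "(LINT y|\<sigma>. indicator {x - M<..} y * tail \<rho> (x - y)) = (LINT y|\<sigma>. LINT z|\<rho>. ?f z y)"
    unfolding tail_eq_integral[OF assms(1)] integral_mult_right_zero[symmetric]
    by (intro Bochner_Integration.integral_cong refl) (auto split: split_indicator)
  also have "\<dots> = (LINT z|\<rho>. LINT y|\<sigma>. ?f z y)"
    by (rule RS.Fubini_integral[OF int])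
  also have "\<dots> = (LINT z|\<rho>. indicator {..M} z * tail \<sigma> (x - z) + indicator {M<..} z * tail \<sigma> (x - M))"
  proof (intro Bochner_Integration.integral_cong refl)
    fix z
    have "(LINT y|\<sigma>. ?f z y) = tail \<sigma> (x - min z M)"
      unfolding tail_eq_integral[OF assms(2)]
      by (intro Bochner_Integration.integral_cong refl) (auto split: split_indicator)
    then show "(LINT y|\<sigma>. ?f z y) =
        indicator {..M} z * tail \<sigma> (x - z) + indicator {M<..} z * tail \<sigma> (x - M)"
      by (auto split: split_indicator simp: min_def)
  qed
  also have "\<dots> = (LINT z|\<rho>. indicator {..M} z * tail \<sigma> (x - z)) + tail \<rho> M * tail \<sigma> (x - M)"
    using i3 i4 by (simp add: tail_def)
  finally show ?thesis by simp
qed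

text \<open>Product term of the split with cut \<open>x\<close>; the other two terms are
  nonnegative. This is the source of the lower bounds for convolution tails.\<close>

lemma tail_mult_le_tail_convolution:
  assumes "real_distribution \<rho>" "real_distribution \<sigma>"
  shows "tail \<rho> x * tail \<sigma> y \<le> tail (\<rho> \<star> \<sigma>) (x + y)"
proof -
  have "0 \<le> (LINT u|\<sigma>. indicator {..x + y - x} u * tail \<rho> (x + y - u))"
    "0 \<le> (LINT u|\<rho>. indicator {..x} u * tail \<sigma> (x + y - u))"
    by (auto intro!: Bochner_Integration.integral_nonneg mult_nonneg_nonneg tail_bounds assms)
  then show ?thesis using tail_convolution_split[OF assms, of "x + y" x] by simp
qed

lemma integrable_bounded_real_distribution:
  fixes f :: "real \<Rightarrow> real"
  assumes "real_distribution \<rho>" "f \<in> borel_measurable borel" "\<And>x. \<bar>f x\<bar> \<le> B"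
  shows "integrable \<rho> f"
proof -
  interpret real_distribution \<rho> by fact
  show ?thesis using assms by (intro integrable_const_bound[where B=B]) auto
qed

lemma tail_convolution_mono:
  assumes \<rho>: "real_distribution \<rho>" and \<tau>: "real_distribution \<tau>" and \<sigma>: "real_distribution \<sigma>"
    and le: "\<And>y. tail \<rho> y \<le> C * tail \<tau> y"
  shows "tail (\<rho> \<star> \<sigma>) x \<le> C * tail (\<tau> \<star> \<sigma>) x"
proof -
  note [measurable] = borel_measurable_tail[OF \<rho>] borel_measurable_tail[OF \<tau>]
  have "(LINT y|\<sigma>. tail \<rho> (x - y)) \<le> (LINT y|\<sigma>. C * tail \<tau> (x - y))"
    by (intro integral_mono integrable_mult_right
          integrable_bounded_real_distribution[OF \<sigma>, where B=1] le)
       (auto simp: tail_bounds \<rho> \<tau>)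
  then show ?thesis by (simp add: tail_convolution \<rho> \<tau> \<sigma>)
qed

subsection \<open>Almost monotone tails\<close>

text \<open>The inequality \<open>tail_mu_conv\<close> is stated on the whole line with one
  constant, not only near infinity, so that it can be used under an integral.\<close>

locale convolution_dominating =
  fixes \<mu> :: "real measure" and \<gamma> :: real
  assumes real_distribution_mu: "real_distribution \<mu>"
    and tail_mu_pos: "\<And>x. 0 < tail \<mu> x"
    and tail_mu_conv: "\<exists>K. \<forall>x. tail (\<mu> \<star> \<mu>) x \<le> K * tail \<mu> x"
    and gamma_pos: "\<gamma> > 0"
begin

definition dominated :: "real measure \<Rightarrow> bool" where
  "dominated \<rho> \<longleftrightarrow> real_distribution \<rho> \<and> (\<exists>C. \<forall>x. tail \<rho> x \<le> C * tail \<mu> x)"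

text \<open>Up to the factor \<open>exp (- \<gamma> * x)\<close>, the drift is the increment of \<open>exp (\<gamma> * x) * tail \<rho> x\<close> over
  a step back of length \<open>a\<close>. It is compared with the tail of \<open>\<mu>\<close>, not of \<open>\<rho>\<close>, because the tail of the
  normalised Levy measure may be much smaller than that of \<open>\<mu>\<close>.\<close>

definition drift :: "real measure \<Rightarrow> real \<Rightarrow> real \<Rightarrow> real" where
  "drift \<rho> a x = exp (- \<gamma> * a) * tail \<rho> (x - a) - tail \<rho> x"

definition asymp_decr :: "real measure \<Rightarrow> bool" where
  "asymp_decr \<rho> \<longleftrightarrow> (\<forall>a\<ge>0. \<forall>\<epsilon>>0. \<forall>\<^sub>F x in at_top. - \<epsilon> * tail \<mu> x \<le> drift \<rho> a x)"

definition asymp_incr :: "real measure \<Rightarrow> bool" where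
  "asymp_incr \<rho> \<longleftrightarrow> (\<forall>a\<ge>0. \<forall>\<epsilon>>0. \<forall>\<^sub>F x in at_top. drift \<rho> a x \<le> \<epsilon> * tail \<mu> x)"

lemma dominated_real_distribution: "dominated \<rho> \<Longrightarrow> real_distribution \<rho>"
  by (simp add: dominated_def)

lemma dominatedE:
  assumes "dominated \<rho>"
  obtains C where "C > 0" "\<And>x. tail \<rho> x \<le> C * tail \<mu> x"
proof -
  from assms obtain C where C: "\<And>x. tail \<rho> x \<le> C * tail \<mu> x" by (auto simp: dominated_def)
  have "tail \<rho> x \<le> max 1 C * tail \<mu> x" for x
    using C[of x] mult_right_mono[of C "max 1 C" "tail \<mu> x"] tail_mu_pos[of x] by linarith
  then show ?thesis using that[of "max 1 C"] by auto
qed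

lemma dominated_mu: "dominated \<mu>"
  unfolding dominated_def using real_distribution_mu by (auto intro: exI[of _ 1])

text \<open>Replace \<open>\<rho>\<close>, then \<open>\<sigma>\<close>, by \<open>\<mu>\<close>
  inside the integral formula for the tail; commutativity brings \<open>\<sigma>\<close> to the
  first place. The remaining \<open>\<mu> \<star> \<mu>\<close> is bounded by
  \<open>tail_mu_conv\<close>.\<close>

lemma dominated_convolution:
  assumes "dominated \<rho>" "dominated \<sigma>"
  shows "dominated (\<rho> \<star> \<sigma>)"
proof -
  note rd = dominated_real_distribution[OF assms(1)] dominated_real_distribution[OF assms(2)]
    real_distribution_mu
  obtain C where C: "C > 0" "\<And>x. tail \<rho> x \<le> C * tail \<mu> x" by (rule dominatedE[OF assms(1)]) blast
  obtain D where D: "D > 0" "\<And>x. tail \<sigma> x \<le> D * tail \<mu> x" by (rule dominatedE[OF assms(2)]) blast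
  obtain K where K: "\<And>x. tail (\<mu> \<star> \<mu>) x \<le> K * tail \<mu> x" using tail_mu_conv by blast
  have "tail (\<rho> \<star> \<sigma>) x \<le> (C * D * K) * tail \<mu> x" for x
  proof -
    have "tail (\<rho> \<star> \<sigma>) x \<le> C * tail (\<mu> \<star> \<sigma>) x"
      by (rule tail_convolution_mono) (use rd C in auto)
    also have "tail (\<mu> \<star> \<sigma>) x = tail (\<sigma> \<star> \<mu>) x"
      using convolution_commute_real rd by metis
    also have "C * tail (\<sigma> \<star> \<mu>) x \<le> C * (D * tail (\<mu> \<star> \<mu>) x)"
      by (intro mult_left_mono tail_convolution_mono) (use rd C D in auto)
    also have "\<dots> \<le> C * (D * (K * tail \<mu> x))"
      using C D K by (intro mult_left_mono) auto
    finally show ?thesis by (simp add: mult.assoc)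
  qed
  then show ?thesis unfolding dominated_def using real_distribution_convolution rd by blast
qed

lemma borel_measurable_drift [measurable]:
  assumes "real_distribution \<rho>"
  shows "drift \<rho> a \<in> borel_measurable borel"
  unfolding drift_def[abs_def] using borel_measurable_tail[OF assms] by measurable

lemma abs_drift_le:
  assumes "real_distribution \<rho>" "a \<ge> 0"
  shows "\<bar>drift \<rho> a x\<bar> \<le> 1"
proof -
  have "exp (- \<gamma> * a) \<le> 1" using assms gamma_pos by simp
  then have "exp (- \<gamma> * a) * tail \<rho> (x - a) \<le> 1 * 1"
    by (intro mult_mono) (auto simp: tail_bounds assms)
  moreover have "0 \<le> exp (- \<gamma> * a) * tail \<rho> (x - a)"
    by (simp add: tail_bounds assms)
  ultimately show ?thesis
    using tail_bounds[OF assms(1), of x] unfolding drift_def by auto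
qed

text \<open>One constant for all error terms of the next estimates: averages of
  \<open>tail \<mu> (x - y)\<close> over either law, the total mass of the strips, and the products
  at the corner of the split.\<close>

lemma dominated_convolution_bound:
  assumes "dominated \<rho>" "dominated \<sigma>"
  obtains D where "D > 0" "\<And>x. tail (\<mu> \<star> \<sigma>) x \<le> D * tail \<mu> x" "\<And>x. tail (\<mu> \<star> \<rho>) x \<le> D * tail \<mu> x"
    "\<And>x. tail (\<sigma> \<star> \<rho>) x \<le> D * tail \<mu> x" "\<And>x y. tail \<mu> y * tail \<sigma> (x - y) \<le> D * tail \<mu> x"
    "\<And>x y. tail \<rho> y * tail \<mu> (x - y) \<le> D * tail \<mu> x"
proof -
  note rd = dominated_real_distribution[OF assms(1)] dominated_real_distribution[OF assms(2)]
    real_distribution_mu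
  obtain D1 where D1: "D1 > 0" "\<And>x. tail (\<mu> \<star> \<sigma>) x \<le> D1 * tail \<mu> x"
    by (rule dominatedE[OF dominated_convolution[OF dominated_mu assms(2)]]) blast
  obtain D2 where D2: "D2 > 0" "\<And>x. tail (\<mu> \<star> \<rho>) x \<le> D2 * tail \<mu> x"
    by (rule dominatedE[OF dominated_convolution[OF dominated_mu assms(1)]]) blast
  obtain D3 where D3: "D3 > 0" "\<And>x. tail (\<sigma> \<star> \<rho>) x \<le> D3 * tail \<mu> x"
    by (rule dominatedE[OF dominated_convolution[OF assms(2) assms(1)]]) blast
  define D where "D = D1 + D2 + D3"
  have le: "D1 * tail \<mu> x \<le> D * tail \<mu> x" "D2 * tail \<mu> x \<le> D * tail \<mu> x"
      "D3 * tail \<mu> x \<le> D * tail \<mu> x" for x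
    using D1 D2 D3 tail_mu_pos[of x] by (auto simp: D_def intro!: mult_right_mono)
  have 3: "tail (\<mu> \<star> \<sigma>) x \<le> D * tail \<mu> x" "tail (\<mu> \<star> \<rho>) x \<le> D * tail \<mu> x"
    "tail (\<sigma> \<star> \<rho>) x \<le> D * tail \<mu> x" for x
    using D1(2)[of x] D2(2)[of x] D3(2)[of x] le[of x] by linarith+
  have 1: "tail \<mu> y * tail \<sigma> (x - y) \<le> D * tail \<mu> x" for x y
    using tail_mult_le_tail_convolution[OF rd(3,2), of y "x - y"] D1(2)[of x] le(1)[of x] by simp
  have 2: "tail \<rho> y * tail \<mu> (x - y) \<le> D * tail \<mu> x" for x y
    using tail_mult_le_tail_convolution[OF rd(3,1), of "x - y" y] D2(2)[of x] le(2)[of x]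
    by (simp add: mult.commute)
  show ?thesis
    by (rule that[OF _ 3 1 2]) (use D1 D2 D3 in \<open>simp add: D_def\<close>)
qed

section \<open>Increments of a convolution\<close>

text \<open>Apply \<open>tail_convolution_split\<close> at \<open>x - a\<close> with cut
  \<open>M - a\<close> and at \<open>x\<close> with cut \<open>M\<close>: the ranges of
  \<open>y\<close> agree, and the difference consists of an average of \<open>drift \<rho>\<close>,
  one of \<open>drift \<sigma>\<close>, a corner term, and minus the mass of the strip
  \<open>{M - a<..M}\<close>. The window \<open>{-N..N}\<close> is kept with its full value for
  \<open>asymp_incr_factor\<close>; elsewhere the drift is only bounded below.\<close>

lemma drift_convolution_ge:
  assumes dom: "dominated \<rho>" "dominated \<sigma>" and decr: "asymp_decr \<rho>" "asymp_decr \<sigma>"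
    and a: "a \<ge> 0" and eps: "\<epsilon> > 0"
  shows "\<forall>\<^sub>F x in at_top. drift (\<rho> \<star> \<sigma>) a x \<ge>
    (LINT y|\<sigma>. indicator {-N..N} y * drift \<rho> a (x - y)) - \<epsilon> * tail \<mu> x"
proof -
  note rd = dominated_real_distribution[OF dom(1)] dominated_real_distribution[OF dom(2)]
    real_distribution_mu
  note [measurable] = borel_measurable_tail[OF rd(1)] borel_measurable_tail[OF rd(2)]
    borel_measurable_tail[OF rd(3)] borel_measurable_drift[OF rd(1)] borel_measurable_drift[OF rd(2)]
  note tb = tail_bounds[OF rd(1)] tail_bounds[OF rd(2)] tail_bounds[OF rd(3)]
  obtain D where D: "D > 0" "\<And>x. tail (\<mu> \<star> \<sigma>) x \<le> D * tail \<mu> x" "\<And>x. tail (\<mu> \<star> \<rho>) x \<le> D * tail \<mu> x"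
    "\<And>x. tail (\<sigma> \<star> \<rho>) x \<le> D * tail \<mu> x" "\<And>x y. tail \<mu> y * tail \<sigma> (x - y) \<le> D * tail \<mu> x"
    by (rule dominated_convolution_bound[OF dom]) blast
  \<comment> \<open>Four errors, each at most \<open>\<delta> * (D * tail \<mu> x)\<close>: the two
    averages, the strip and the corner.\<close>
  define \<delta> where "\<delta> = \<epsilon> / (4 * D)"
  have \<delta>: "\<delta> > 0" "4 * (\<delta> * D) = \<epsilon>" using eps D(1) by (auto simp: \<delta>_def)
  obtain n :: nat where n: "n > 0" "1 / real n < \<delta>"
    using \<delta>(1) by (metis nat_approx_posE zero_less_Suc)
  have "\<forall>\<^sub>F x in at_top. - \<delta> * tail \<mu> x \<le> drift \<rho> a x \<and> - \<delta> * tail \<mu> x \<le> drift \<sigma> a x"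
    using decr a \<delta>(1) unfolding asymp_decr_def by (auto intro: eventually_conj)
  then obtain M1 where M1: "\<And>u. u \<ge> M1 \<Longrightarrow> - \<delta> * tail \<mu> u \<le> drift \<rho> a u \<and> - \<delta> * tail \<mu> u \<le> drift \<sigma> a u"
    by (auto simp: eventually_at_top_linorder)
  define M0 where "M0 = max 0 M1"
  have M0: "M0 \<ge> 0" and
    M0\<rho>: "\<And>u. u \<ge> M0 \<Longrightarrow> - \<delta> * tail \<mu> u \<le> drift \<rho> a u" and
    M0\<sigma>: "\<And>u. u \<ge> M0 \<Longrightarrow> - \<delta> * tail \<mu> u \<le> drift \<sigma> a u"
    using M1 by (auto simp: M0_def)
  \<comment> \<open>For every cut \<open>M\<close> between \<open>M0\<close> and
    \<open>M0 + real n * a\<close> the bound on \<open>x\<close> gives \<open>x - M >= M0\<close>,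
    so both drift bounds apply, and \<open>x - M >= N\<close>, so the window lies in the range of
    \<open>y\<close>.\<close>
  have "(LINT y|\<sigma>. indicator {-N..N} y * drift \<rho> a (x - y)) - \<epsilon> * tail \<mu> x \<le> drift (\<rho> \<star> \<sigma>) a x"
    if x: "x \<ge> max N M0 + M0 + real n * a" for x
  proof -
    define J where "J k = (LINT z|\<rho>. indicator {M0 + real k * a<..M0 + real (Suc k) * a} z * tail \<sigma> (x - z))" for k
    have int_ind: "integrable \<rho> (\<lambda>z. indicator A z * tail \<sigma> (x - z))"
      if "A \<in> sets borel" for A
      using that by (intro integrable_bounded_real_distribution[OF rd(1), where B=1])
        (auto split: split_indicator simp: tb)
    have sumJ: "(\<Sum>k<m. J k) = (LINT z|\<rho>. indicator {M0<..M0 + real m * a} z * tail \<sigma> (x - z))" for m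
    proof (induction m)
      case (Suc m)
      define L where "L = M0 + real m * a"
      have L: "M0 \<le> L" "M0 + real (Suc m) * a = L + a"
        using a by (auto simp: L_def algebra_simps)
      have "(LINT z|\<rho>. indicator {M0<..M0 + real (Suc m) * a} z * tail \<sigma> (x - z)) =
        (LINT z|\<rho>. indicator {M0<..M0 + real m * a} z * tail \<sigma> (x - z) +
          indicator {M0 + real m * a<..M0 + real (Suc m) * a} z * tail \<sigma> (x - z))"
        unfolding L(2) unfolding L_def[symmetric] using a L(1)
        by (intro Bochner_Integration.integral_cong refl) (auto split: split_indicator)
      also have "\<dots> = (\<Sum>k<Suc m. J k)"
        using Suc by (simp add: J_def int_ind)
      finally show ?case ..
    qed simp
    have "(\<Sum>k<n. J k) \<le> (LINT z|\<rho>. tail \<sigma> (x - z))"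
      unfolding sumJ using int_ind[of UNIV]
      by (intro integral_mono int_ind) (auto split: split_indicator simp: tb)
    also have "\<dots> \<le> D * tail \<mu> x" using D(4)[of x] by (simp add: tail_convolution rd)
    finally have sJ: "(\<Sum>k<n. J k) \<le> D * tail \<mu> x" .
    \<comment> \<open>Pigeonhole: one of the \<open>n\<close> disjoint strips carries at most the average mass.\<close>
    have "\<exists>k<n. J k \<le> D * tail \<mu> x / n"
    proof (rule ccontr)
      assume "\<not> ?thesis"
      then have "(\<Sum>k<n. D * tail \<mu> x / n) < (\<Sum>k<n. J k)"
        using n(1) by (intro sum_strict_mono) auto
      then show False using sJ n(1) by simp
    qed
    then obtain k where k: "k < n" "J k \<le> D * tail \<mu> x / n" by blast
    \<comment> \<open>Upper end of strip \<open>k\<close>, which is therefore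
      \<open>{M - a<..M}\<close>. The cut depends on \<open>x\<close> but never exceeds
      \<open>M0 + real n * a\<close>.\<close>
    define M where "M = M0 + real (Suc k) * a"
    have "real (Suc k) * a \<le> real n * a" using k a by (intro mult_right_mono) auto
    then have xM: "x - M \<ge> M0" "x - M \<ge> N" using x by (auto simp: M_def)
    have "0 \<le> real k * a" using a by simp
    then have Ma: "M - a \<ge> M0" "M \<ge> M0" using a by (auto simp: M_def algebra_simps)
    have Jk: "J k = (LINT z|\<rho>. indicator {M - a<..M} z * tail \<sigma> (x - z))"
      by (simp add: J_def M_def algebra_simps)
    have "J k \<le> D * tail \<mu> x * (1 / n)" using k by simp
    also have "\<dots> \<le> D * tail \<mu> x * \<delta>"
      using n D(1) tail_mu_pos[of x] by (intro mult_left_mono) auto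
    finally have Jb: "J k \<le> \<delta> * (D * tail \<mu> x)" by (simp add: mult_ac)

    have i\<sigma>: "integrable \<sigma> (\<lambda>y. indicator A y * tail \<rho> (u - y))" if "A \<in> sets borel" for A u
      using that by (intro integrable_bounded_real_distribution[OF rd(2), where B=1])
        (auto split: split_indicator simp: tb)
    have i\<rho>: "integrable \<rho> (\<lambda>y. indicator A y * tail \<sigma> (u - y))" if "A \<in> sets borel" for A u
      using that by (intro integrable_bounded_real_distribution[OF rd(1), where B=1])
        (auto split: split_indicator simp: tb)
    have id\<sigma>: "integrable \<sigma> (\<lambda>y. indicator A y * drift \<rho> a (u - y))" if "A \<in> sets borel" for A u
      using that abs_drift_le[OF rd(1) a]
      by (intro integrable_bounded_real_distribution[OF rd(2), where B=1]) (auto split: split_indicator)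
    have id\<rho>: "integrable \<rho> (\<lambda>y. indicator A y * drift \<sigma> a (u - y))" if "A \<in> sets borel" for A u
      using that abs_drift_le[OF rd(2) a]
      by (intro integrable_bounded_real_distribution[OF rd(1), where B=1]) (auto split: split_indicator)
    have i\<mu>: "integrable \<sigma> (\<lambda>y. tail \<mu> (x - y))" "integrable \<rho> (\<lambda>y. tail \<mu> (x - y))"
      by (intro integrable_bounded_real_distribution[where B=1] rd; auto simp: tb)+

    have e1: "(LINT y|\<sigma>. indicator {..x - M} y * drift \<rho> a (x - y)) =
      exp (- \<gamma> * a) * (LINT y|\<sigma>. indicator {..x - M} y * tail \<rho> (x - a - y)) -
      (LINT y|\<sigma>. indicator {..x - M} y * tail \<rho> (x - y))"
    proof -
      have "tail \<rho> (x - y - a) = tail \<rho> (x - a - y)" for y by (rule arg_cong[where f="tail \<rho>"]) simp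
      then have "(LINT y|\<sigma>. indicator {..x - M} y * drift \<rho> a (x - y)) =
        (LINT y|\<sigma>. exp (- \<gamma> * a) * (indicator {..x - M} y * tail \<rho> (x - a - y)) -
          indicator {..x - M} y * tail \<rho> (x - y))"
        unfolding drift_def by (intro Bochner_Integration.integral_cong refl) (simp add: right_diff_distrib mult_ac)
      then show ?thesis by (simp add: i\<sigma>)
    qed
    have e2: "(LINT y|\<rho>. indicator {..M - a} y * drift \<sigma> a (x - y)) =
      exp (- \<gamma> * a) * (LINT y|\<rho>. indicator {..M - a} y * tail \<sigma> (x - a - y)) -
      (LINT y|\<rho>. indicator {..M - a} y * tail \<sigma> (x - y))"
    proof -
      have "tail \<sigma> (x - y - a) = tail \<sigma> (x - a - y)" for y by (rule arg_cong[where f="tail \<sigma>"]) simp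
      then have "(LINT y|\<rho>. indicator {..M - a} y * drift \<sigma> a (x - y)) =
        (LINT y|\<rho>. exp (- \<gamma> * a) * (indicator {..M - a} y * tail \<sigma> (x - a - y)) -
          indicator {..M - a} y * tail \<sigma> (x - y))"
        unfolding drift_def by (intro Bochner_Integration.integral_cong refl) (simp add: right_diff_distrib mult_ac)
      then show ?thesis by (simp add: i\<rho>)
    qed
    have "(LINT z|\<rho>. indicator {..M} z * tail \<sigma> (x - z)) =
      (LINT z|\<rho>. indicator {..M - a} z * tail \<sigma> (x - z) + indicator {M - a<..M} z * tail \<sigma> (x - z))"
      using a by (intro Bochner_Integration.integral_cong refl) (auto split: split_indicator)
    also have "\<dots> = (LINT z|\<rho>. indicator {..M - a} z * tail \<sigma> (x - z)) + J k"
      by (simp add: i\<rho> Jk)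
    finally have e3: "(LINT z|\<rho>. indicator {..M} z * tail \<sigma> (x - z)) =
      (LINT z|\<rho>. indicator {..M - a} z * tail \<sigma> (x - z)) + J k" .
    have eq: "drift (\<rho> \<star> \<sigma>) a x = (LINT y|\<sigma>. indicator {..x - M} y * drift \<rho> a (x - y)) +
      (LINT y|\<rho>. indicator {..M - a} y * drift \<sigma> a (x - y)) - J k + drift \<rho> a M * tail \<sigma> (x - M)"
      unfolding e1 e2 unfolding drift_def
      using tail_convolution_split[OF rd(1,2), of "x - a" "M - a"]
        tail_convolution_split[OF rd(1,2), of x M]
      by (simp add: e3 algebra_simps)

    \<comment> \<open>Outside the window the drift is at least
      \<open>- \<delta> * tail \<mu> (x - y)\<close>; on the window the subtracted term only lowers
      the left side.\<close>
    have "(LINT y|\<sigma>. indicator {-N..N} y * drift \<rho> a (x - y)) - \<delta> * (LINT y|\<sigma>. tail \<mu> (x - y)) =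
        (LINT y|\<sigma>. indicator {-N..N} y * drift \<rho> a (x - y) - \<delta> * tail \<mu> (x - y))"
      using id\<sigma> i\<mu> by simp
    also have "\<dots> \<le> (LINT y|\<sigma>. indicator {..x - M} y * drift \<rho> a (x - y))"
    proof (intro integral_mono Bochner_Integration.integrable_diff integrable_mult_right id\<sigma> i\<mu>)
      fix y
      show "indicator {-N..N} y * drift \<rho> a (x - y) - \<delta> * tail \<mu> (x - y)
        \<le> indicator {..x - M} y * drift \<rho> a (x - y)"
        using xM M0\<rho>[of "x - y"] Ma \<delta>(1) tail_mu_pos[of "x - y"]
        by (auto split: split_indicator)
    qed auto
    finally have b0: "(LINT y|\<sigma>. indicator {-N..N} y * drift \<rho> a (x - y)) -
      \<delta> * (LINT y|\<sigma>. tail \<mu> (x - y)) \<le> (LINT y|\<sigma>. indicator {..x - M} y * drift \<rho> a (x - y))" .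
    have "\<delta> * (LINT y|\<sigma>. tail \<mu> (x - y)) \<le> \<delta> * (D * tail \<mu> x)"
      using D(2)[of x] \<delta>(1) by (simp add: tail_convolution rd)
    with b0 have b1: "(LINT y|\<sigma>. indicator {-N..N} y * drift \<rho> a (x - y)) - \<delta> * (D * tail \<mu> x)
      \<le> (LINT y|\<sigma>. indicator {..x - M} y * drift \<rho> a (x - y))"
      by linarith
    have "- \<delta> * (LINT y|\<rho>. tail \<mu> (x - y)) = (LINT y|\<rho>. - \<delta> * tail \<mu> (x - y))"
      by simp
    also have "\<dots> \<le> (LINT y|\<rho>. indicator {..M - a} y * drift \<sigma> a (x - y))"
    proof (intro integral_mono integrable_mult_right id\<rho> i\<mu>)
      fix y
      show "- \<delta> * tail \<mu> (x - y) \<le> indicator {..M - a} y * drift \<sigma> a (x - y)"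
        using xM a M0\<sigma>[of "x - y"] Ma \<delta>(1) tail_mu_pos[of "x - y"]
        by (auto split: split_indicator)
    qed auto
    also have "- \<delta> * (D * tail \<mu> x) \<le> - \<delta> * (LINT y|\<rho>. tail \<mu> (x - y))"
      using D(3)[of x] \<delta>(1) by (simp add: tail_convolution rd)
    finally have b2: "- \<delta> * (D * tail \<mu> x) \<le> (LINT y|\<rho>. indicator {..M - a} y * drift \<sigma> a (x - y))"
      by simp
    have "- \<delta> * (D * tail \<mu> x) \<le> - \<delta> * (tail \<mu> M * tail \<sigma> (x - M))"
      using D(5)[of M x] \<delta>(1) by simp
    also have "\<dots> \<le> drift \<rho> a M * tail \<sigma> (x - M)"
      using M0\<rho>[of M] Ma mult_right_mono[of "- \<delta> * tail \<mu> M" "drift \<rho> a M" "tail \<sigma> (x - M)"] tb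
      by (simp add: mult_ac)
    finally have b3: "- \<delta> * (D * tail \<mu> x) \<le> drift \<rho> a M * tail \<sigma> (x - M)" .
    have "\<epsilon> * tail \<mu> x = 4 * (\<delta> * (D * tail \<mu> x))" unfolding \<delta>(2)[symmetric] by simp
    then show ?thesis using eq b1 b2 b3 Jb by linarith
  qed
  then show ?thesis by (auto simp: eventually_at_top_linorder)
qed

lemma asymp_decr_convolution:
  assumes "dominated \<rho>" "dominated \<sigma>" "asymp_decr \<rho>" "asymp_decr \<sigma>"
  shows "asymp_decr (\<rho> \<star> \<sigma>)"
  unfolding asymp_decr_def
proof (intro allI impI)
  fix a \<epsilon> :: real assume "0 \<le> a" "0 < \<epsilon>"
  \<comment> \<open>The window is empty for \<open>N = -1\<close>, which leaves only the error
    term.\<close>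
  then show "\<forall>\<^sub>F x in at_top. - \<epsilon> * tail \<mu> x \<le> drift (\<rho> \<star> \<sigma>) a x"
    using drift_convolution_ge[OF assms, of a \<epsilon> "-1"] by simp
qed

text \<open>Here the same cut \<open>M\<close> serves at \<open>x - a\<close> and at
  \<open>x\<close>. The ranges of \<open>z\<close> agree, while the range of \<open>y\<close> is
  longer at \<open>x\<close>; the surplus is subtracted, so an upper bound may drop it and a fixed
  cut suffices.\<close>

lemma asymp_incr_convolution:
  assumes dom: "dominated \<rho>" "dominated \<sigma>" and incr: "asymp_incr \<rho>" "asymp_incr \<sigma>"
  shows "asymp_incr (\<rho> \<star> \<sigma>)"
  unfolding asymp_incr_def
proof (intro allI impI)
  fix a \<epsilon> :: real assume a: "0 \<le> a" and eps: "0 < \<epsilon>"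
  note rd = dominated_real_distribution[OF dom(1)] dominated_real_distribution[OF dom(2)]
    real_distribution_mu
  note [measurable] = borel_measurable_tail[OF rd(1)] borel_measurable_tail[OF rd(2)]
    borel_measurable_tail[OF rd(3)] borel_measurable_drift[OF rd(1)] borel_measurable_drift[OF rd(2)]
  note tb = tail_bounds[OF rd(1)] tail_bounds[OF rd(2)] tail_bounds[OF rd(3)]
  obtain D where D: "D > 0" "\<And>x. tail (\<mu> \<star> \<sigma>) x \<le> D * tail \<mu> x" "\<And>x. tail (\<mu> \<star> \<rho>) x \<le> D * tail \<mu> x"
    "\<And>x. tail (\<sigma> \<star> \<rho>) x \<le> D * tail \<mu> x" "\<And>x y. tail \<mu> y * tail \<sigma> (x - y) \<le> D * tail \<mu> x"
    "\<And>x y. tail \<rho> y * tail \<mu> (x - y) \<le> D * tail \<mu> x"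
    by (rule dominated_convolution_bound[OF dom]) blast
  \<comment> \<open>Three errors: the two averages and the corner.\<close>
  define \<delta> where "\<delta> = \<epsilon> / (3 * D)"
  have \<delta>: "\<delta> > 0" "3 * (\<delta> * D) = \<epsilon>" using eps D(1) by (auto simp: \<delta>_def)
  have "\<forall>\<^sub>F x in at_top. drift \<rho> a x \<le> \<delta> * tail \<mu> x \<and> drift \<sigma> a x \<le> \<delta> * tail \<mu> x"
    using incr a \<delta>(1) unfolding asymp_incr_def by (auto intro: eventually_conj)
  then obtain M where M\<rho>: "\<And>u. u \<ge> M \<Longrightarrow> drift \<rho> a u \<le> \<delta> * tail \<mu> u"
    and M\<sigma>: "\<And>u. u \<ge> M \<Longrightarrow> drift \<sigma> a u \<le> \<delta> * tail \<mu> u"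
    by (auto simp: eventually_at_top_linorder)
  have "drift (\<rho> \<star> \<sigma>) a x \<le> \<epsilon> * tail \<mu> x" if x: "x \<ge> 2 * M" for x
  proof -
    have xM: "x - M \<ge> M" using x by simp
    have i\<sigma>: "integrable \<sigma> (\<lambda>y. indicator A y * tail \<rho> (u - y))" if "A \<in> sets borel" for A u
      using that by (intro integrable_bounded_real_distribution[OF rd(2), where B=1])
        (auto split: split_indicator simp: tb)
    have i\<rho>: "integrable \<rho> (\<lambda>y. indicator A y * tail \<sigma> (u - y))" if "A \<in> sets borel" for A u
      using that by (intro integrable_bounded_real_distribution[OF rd(1), where B=1])
        (auto split: split_indicator simp: tb)
    have id\<sigma>: "integrable \<sigma> (\<lambda>y. indicator A y * drift \<rho> a (u - y))" if "A \<in> sets borel" for A u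
      using that abs_drift_le[OF rd(1) a]
      by (intro integrable_bounded_real_distribution[OF rd(2), where B=1]) (auto split: split_indicator)
    have id\<rho>: "integrable \<rho> (\<lambda>y. indicator A y * drift \<sigma> a (u - y))" if "A \<in> sets borel" for A u
      using that abs_drift_le[OF rd(2) a]
      by (intro integrable_bounded_real_distribution[OF rd(1), where B=1]) (auto split: split_indicator)
    have i\<mu>: "integrable \<sigma> (\<lambda>y. tail \<mu> (x - y))" "integrable \<rho> (\<lambda>y. tail \<mu> (x - y))"
      by (intro integrable_bounded_real_distribution[where B=1] rd; auto simp: tb)+

    have e1: "(LINT y|\<sigma>. indicator {..x - a - M} y * drift \<rho> a (x - y)) =
      exp (- \<gamma> * a) * (LINT y|\<sigma>. indicator {..x - a - M} y * tail \<rho> (x - a - y)) -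
      (LINT y|\<sigma>. indicator {..x - a - M} y * tail \<rho> (x - y))"
    proof -
      have "tail \<rho> (x - y - a) = tail \<rho> (x - a - y)" for y by (rule arg_cong[where f="tail \<rho>"]) simp
      then have "(LINT y|\<sigma>. indicator {..x - a - M} y * drift \<rho> a (x - y)) =
        (LINT y|\<sigma>. exp (- \<gamma> * a) * (indicator {..x - a - M} y * tail \<rho> (x - a - y)) -
          indicator {..x - a - M} y * tail \<rho> (x - y))"
        unfolding drift_def by (intro Bochner_Integration.integral_cong refl) (simp add: right_diff_distrib mult_ac)
      then show ?thesis by (simp add: i\<sigma>)
    qed
    have e2: "(LINT y|\<rho>. indicator {..M} y * drift \<sigma> a (x - y)) =
      exp (- \<gamma> * a) * (LINT y|\<rho>. indicator {..M} y * tail \<sigma> (x - a - y)) -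
      (LINT y|\<rho>. indicator {..M} y * tail \<sigma> (x - y))"
    proof -
      have "tail \<sigma> (x - y - a) = tail \<sigma> (x - a - y)" for y by (rule arg_cong[where f="tail \<sigma>"]) simp
      then have "(LINT y|\<rho>. indicator {..M} y * drift \<sigma> a (x - y)) =
        (LINT y|\<rho>. exp (- \<gamma> * a) * (indicator {..M} y * tail \<sigma> (x - a - y)) -
          indicator {..M} y * tail \<sigma> (x - y))"
        unfolding drift_def by (intro Bochner_Integration.integral_cong refl) (simp add: right_diff_distrib mult_ac)
      then show ?thesis by (simp add: i\<rho>)
    qed
    have e3: "(LINT y|\<sigma>. indicator {..x - a - M} y * tail \<rho> (x - y)) \<le>
      (LINT y|\<sigma>. indicator {..x - M} y * tail \<rho> (x - y))"
      using a by (intro integral_mono i\<sigma>) (auto split: split_indicator simp: tb)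
    have eq: "drift (\<rho> \<star> \<sigma>) a x \<le> (LINT y|\<sigma>. indicator {..x - a - M} y * drift \<rho> a (x - y)) +
      (LINT y|\<rho>. indicator {..M} y * drift \<sigma> a (x - y)) + tail \<rho> M * drift \<sigma> a (x - M)"
      unfolding e1 e2 unfolding drift_def
      using tail_convolution_split[OF rd(1,2), of "x - a" M]
        tail_convolution_split[OF rd(1,2), of x M] e3
      by (simp add: algebra_simps)
    have "(LINT y|\<sigma>. indicator {..x - a - M} y * drift \<rho> a (x - y)) \<le> (LINT y|\<sigma>. \<delta> * tail \<mu> (x - y))"
    proof (intro integral_mono integrable_mult_right id\<sigma> i\<mu>)
      fix y
      show "indicator {..x - a - M} y * drift \<rho> a (x - y) \<le> \<delta> * tail \<mu> (x - y)"
        using a M\<rho>[of "x - y"] \<delta>(1) tail_mu_pos[of "x - y"]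
        by (auto split: split_indicator)
    qed auto
    also have "\<dots> \<le> \<delta> * (D * tail \<mu> x)"
      using D(2)[of x] \<delta>(1) by (simp add: tail_convolution rd)
    finally have b1: "(LINT y|\<sigma>. indicator {..x - a - M} y * drift \<rho> a (x - y)) \<le> \<delta> * (D * tail \<mu> x)" .
    have "(LINT y|\<rho>. indicator {..M} y * drift \<sigma> a (x - y)) \<le> (LINT y|\<rho>. \<delta> * tail \<mu> (x - y))"
    proof (intro integral_mono integrable_mult_right id\<rho> i\<mu>)
      fix y
      show "indicator {..M} y * drift \<sigma> a (x - y) \<le> \<delta> * tail \<mu> (x - y)"
        using xM M\<sigma>[of "x - y"] \<delta>(1) tail_mu_pos[of "x - y"]
        by (auto split: split_indicator)
    qed auto
    also have "\<dots> \<le> \<delta> * (D * tail \<mu> x)"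
      using D(3)[of x] \<delta>(1) by (simp add: tail_convolution rd)
    finally have b2: "(LINT y|\<rho>. indicator {..M} y * drift \<sigma> a (x - y)) \<le> \<delta> * (D * tail \<mu> x)" .
    have "tail \<rho> M * drift \<sigma> a (x - M) \<le> tail \<rho> M * (\<delta> * tail \<mu> (x - M))"
      using M\<sigma>[of "x - M"] xM tb by (intro mult_left_mono) auto
    also have "\<dots> \<le> \<delta> * (D * tail \<mu> x)"
      using D(6)[of M x] \<delta>(1) by simp
    finally have b3: "tail \<rho> M * drift \<sigma> a (x - M) \<le> \<delta> * (D * tail \<mu> x)" .
    have "\<epsilon> * tail \<mu> x = 3 * (\<delta> * (D * tail \<mu> x))" unfolding \<delta>(2)[symmetric] by simp
    then show ?thesis using eq b1 b2 b3 by linarith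
  qed
  then show "\<forall>\<^sub>F x in at_top. drift (\<rho> \<star> \<sigma>) a x \<le> \<epsilon> * tail \<mu> x"
    by (auto simp: eventually_at_top_linorder)
qed

end

section \<open>Exponential decay and light tails\<close>

text \<open>Only the right tail is restricted, and by every exponential rate: the rate at which
  \<open>tail \<mu>\<close> decays is not known in advance.\<close>

definition light_tailed :: "real measure \<Rightarrow> bool" where
  "light_tailed \<sigma> \<longleftrightarrow> real_distribution \<sigma> \<and> (\<forall>c>0. integrable \<sigma> (\<lambda>x. exp (c * x)))"

lemma tail_le_exp_moment:
  assumes "real_distribution \<sigma>" "integrable \<sigma> (\<lambda>x. exp (c * x))" "c \<ge> 0"
  shows "tail \<sigma> x \<le> exp (- c * x) * (LINT y|\<sigma>. exp (c * y))"
proof -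
  interpret real_distribution \<sigma> by fact
  have "exp (c * x) * tail \<sigma> x = (LINT y|\<sigma>. exp (c * x) * indicator {x<..} y)"
    by (simp add: tail_def)
  also have "\<dots> \<le> (LINT y|\<sigma>. exp (c * y))"
    using assms(3) by (intro integral_mono integrable_bounded_real_distribution[OF assms(1), where B="exp (c * x)"] assms(2))
       (auto split: split_indicator intro: mult_left_mono)
  finally show ?thesis
    by (simp add: exp_minus field_simps)
qed

context convolution_dominating
begin

text \<open>Two independent summands above \<open>1\<close> and \<open>x - 1\<close> have a sum
  above \<open>x\<close>; hence a unit step costs a constant factor, and iteration gives an
  exponential. The \<open>z + 1\<close> absorbs rounding \<open>z\<close> up to an integer.\<close>

lemma tail_mu_shift:
  obtains \<kappa> where "\<kappa> > 0" "\<And>x z. z \<ge> 0 \<Longrightarrow> tail \<mu> (x - z) \<le> exp (\<kappa> * (z + 1)) * tail \<mu> x"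
proof -
  note rd = real_distribution_mu
  obtain K where K: "\<And>x. tail (\<mu> \<star> \<mu>) x \<le> K * tail \<mu> x" using tail_mu_conv by blast
  \<comment> \<open>The maximum with \<open>exp 1\<close> makes \<open>\<kappa> = ln C\<close> at
    least \<open>1\<close>.\<close>
  define C where "C = max (exp 1) (K / tail \<mu> 1)"
  define \<kappa> where "\<kappa> = ln C"
  have C: "C \<ge> exp 1" by (simp add: C_def)
  then have C0: "C > 0" using exp_gt_zero[of "1::real"] by linarith
  have \<kappa>: "\<kappa> \<ge> 1" "exp \<kappa> = C" using C C0 by (auto simp: \<kappa>_def ln_ge_iff)
  have step: "tail \<mu> (x - 1) \<le> C * tail \<mu> x" for x
  proof -
    have "tail \<mu> 1 * tail \<mu> (x - 1) \<le> K * tail \<mu> x"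
      using tail_mult_le_tail_convolution[OF rd rd, of 1 "x - 1"] K[of x] by simp
    then have "tail \<mu> (x - 1) \<le> K / tail \<mu> 1 * tail \<mu> x"
      using tail_mu_pos[of 1] by (simp add: field_simps)
    also have "\<dots> \<le> C * tail \<mu> x"
      using tail_mu_pos[of x] by (intro mult_right_mono) (auto simp: C_def)
    finally show ?thesis .
  qed
  have steps: "tail \<mu> (x - real n) \<le> C ^ n * tail \<mu> x" for x n
  proof (induction n)
    case (Suc n)
    have "tail \<mu> (x - real (Suc n)) \<le> C * tail \<mu> (x - real n)"
      using step[of "x - real n"] by (simp add: algebra_simps)
    also have "\<dots> \<le> C * (C ^ n * tail \<mu> x)" using Suc C0 by (intro mult_left_mono) auto
    finally show ?case by (simp add: mult_ac)
  qed simp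
  have "tail \<mu> (x - z) \<le> exp (\<kappa> * (z + 1)) * tail \<mu> x" if "z \<ge> 0" for x z
  proof -
    have n: "z \<le> real (nat \<lceil>z\<rceil>)" "real (nat \<lceil>z\<rceil>) \<le> z + 1" using that by linarith+
    have "tail \<mu> (x - z) \<le> tail \<mu> (x - real (nat \<lceil>z\<rceil>))"
      using n by (intro tail_antimono rd) auto
    also have "\<dots> \<le> exp (\<kappa> * real (nat \<lceil>z\<rceil>)) * tail \<mu> x"
      using steps[of x "nat \<lceil>z\<rceil>"] by (simp add: exp_of_nat2_mult \<kappa>(2))
    also have "\<dots> \<le> exp (\<kappa> * (z + 1)) * tail \<mu> x"
      using n \<kappa>(1) tail_mu_pos[of x] by (intro mult_right_mono) auto
    finally show ?thesis .
  qed
  then show ?thesis using that[of \<kappa>] \<kappa>(1) by auto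
qed

lemma dominated_shift:
  assumes rd: "real_distribution \<rho>" and le: "\<And>x. tail \<rho> x \<le> C * tail \<mu> (x - c)"
  shows "dominated \<rho>"
proof -
  obtain \<kappa> where \<kappa>: "\<kappa> > 0" "\<And>x z. z \<ge> 0 \<Longrightarrow> tail \<mu> (x - z) \<le> exp (\<kappa> * (z + 1)) * tail \<mu> x"
    by (rule tail_mu_shift) blast
  have "tail \<rho> x \<le> (\<bar>C\<bar> * exp (\<kappa> * (\<bar>c\<bar> + 1))) * tail \<mu> x" for x
  proof -
    have "tail \<rho> x \<le> C * tail \<mu> (x - c)" by (rule le)
    also have "\<dots> \<le> \<bar>C\<bar> * tail \<mu> (x - \<bar>c\<bar>)"
      by (intro mult_mono tail_antimono real_distribution_mu) (auto simp: tail_bounds real_distribution_mu)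
    also have "\<dots> \<le> \<bar>C\<bar> * (exp (\<kappa> * (\<bar>c\<bar> + 1)) * tail \<mu> x)"
      by (intro mult_left_mono \<kappa>) auto
    finally show ?thesis by (simp add: mult_ac)
  qed
  then show ?thesis unfolding dominated_def using rd by blast
qed

text \<open>\<open>\<sigma>\<close> charges some half-line \<open>{- c<..}\<close>, so the tail of
  the convolution at \<open>x - c\<close> is at least a fixed multiple of
  \<open>tail \<rho> x\<close>; \<open>dominated_shift\<close> undoes the shift.\<close>

lemma dominated_factor:
  assumes dom: "dominated (\<rho> \<star> \<sigma>)" and rd: "real_distribution \<rho>" "real_distribution \<sigma>"
  shows "dominated \<rho>"
proof -
  obtain c where c: "c > 0" "tail \<sigma> (- c) > 0" by (rule ex_tail_pos[OF rd(2)])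
  obtain C where C: "C > 0" "\<And>x. tail (\<rho> \<star> \<sigma>) x \<le> C * tail \<mu> x" by (rule dominatedE[OF dom]) blast
  have "tail \<rho> x \<le> (C / tail \<sigma> (- c)) * tail \<mu> (x - c)" for x
    using tail_mult_le_tail_convolution[OF rd, of x "- c"] C(2)[of "x - c"] c(2)
    by (simp add: field_simps)
  then show ?thesis by (rule dominated_shift[OF rd(1)])
qed

text \<open>\<open>asymp_decr\<close> gives a threshold for each step length separately. A grid of
  width \<open>h\<close> reduces \<open>{0..B}\<close> to finitely many lengths; between grid points
  the tail moves in the favourable direction and only a factor \<open>exp (- (\<gamma> * h))\<close>
  is lost.\<close>

lemma asymp_decr_uniform:
  assumes dom: "dominated \<rho>" and decr: "asymp_decr \<rho>" and \<delta>: "\<delta> > 0"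
  shows "\<forall>\<^sub>F w in at_top. \<forall>v\<in>{0..B}. - \<delta> * tail \<mu> w \<le> drift \<rho> v w"
proof -
  note rd = dominated_real_distribution[OF dom]
  obtain C where C: "C > 0" "\<And>x. tail \<rho> x \<le> C * tail \<mu> x" by (rule dominatedE[OF dom]) blast
  \<comment> \<open>With this width the lost factor costs at most
    \<open>\<gamma> * h * C = \<delta> / 2\<close> times \<open>tail \<mu> w\<close>; the grid
    points use the other half.\<close>
  define h where "h = \<delta> / (2 * C * \<gamma>)"
  have h: "h > 0" "\<gamma> * h * C = \<delta> / 2" using C \<delta> gamma_pos by (auto simp: h_def)
  have "\<forall>\<^sub>F w in at_top. \<forall>k\<in>{..nat \<lfloor>B / h\<rfloor>}. - (\<delta> / 2) * tail \<mu> w \<le> drift \<rho> (real k * h) w"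
  proof (intro eventually_ball_finite ballI)
    fix k
    have "0 \<le> real k * h" "\<delta> / 2 > 0" using h \<delta> by auto
    then show "\<forall>\<^sub>F w in at_top. - (\<delta> / 2) * tail \<mu> w \<le> drift \<rho> (real k * h) w"
      using decr unfolding asymp_decr_def by blast
  qed simp
  then show ?thesis
  proof eventually_elim
    case (elim w)
    show ?case
    proof
      fix v assume v: "v \<in> {0..B}"
      define k where "k = nat \<lfloor>v / h\<rfloor>"
      have "v / h \<le> B / h" using v h by (simp add: divide_right_mono)
      then have "k \<le> nat \<lfloor>B / h\<rfloor>" unfolding k_def by (intro nat_mono floor_mono)
      then have d: "- (\<delta> / 2) * tail \<mu> w \<le> drift \<rho> (real k * h) w" using elim by auto
      have "0 \<le> v / h" using v h by simp
      then have "real k \<le> v / h" "v / h \<le> real k + 1" unfolding k_def by linarith+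
      then have k: "real k * h \<le> v" "v \<le> real k * h + h"
        using h by (auto simp: field_simps)
      define r where "r = exp (- (\<gamma> * h))"
      have r: "0 \<le> r" "r \<le> 1" "1 - r \<le> \<gamma> * h"
        using h gamma_pos exp_ge_add_one_self[of "- (\<gamma> * h)"] by (auto simp: r_def)
      have "(1 - r) * tail \<rho> w \<le> (\<gamma> * h) * (C * tail \<mu> w)"
        using r C h gamma_pos by (intro mult_mono) (auto simp: tail_bounds rd)
      also have "\<dots> = \<delta> / 2 * tail \<mu> w" using h(2) by (simp add: mult_ac)
      finally have 1: "tail \<rho> w - \<delta> / 2 * tail \<mu> w \<le> r * tail \<rho> w" by (simp add: algebra_simps)
      have "- (\<delta> / 2) * tail \<mu> w \<le> r * (- (\<delta> / 2) * tail \<mu> w)"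
        using r \<delta> tail_mu_pos[of w] by (simp add: mult_left_le_one_le)
      also have "\<dots> \<le> r * drift \<rho> (real k * h) w" using r d by (intro mult_left_mono) auto
      also have "\<dots> = r * (exp (- \<gamma> * (real k * h)) * tail \<rho> (w - real k * h)) - r * tail \<rho> w"
        by (simp add: drift_def algebra_simps)
      also have "r * (exp (- \<gamma> * (real k * h)) * tail \<rho> (w - real k * h)) =
          exp (- \<gamma> * (real k * h + h)) * tail \<rho> (w - real k * h)"
      proof -
        have "r * exp (- \<gamma> * (real k * h)) = exp (- \<gamma> * (real k * h + h))"
          unfolding r_def exp_add[symmetric] by (simp add: algebra_simps)
        then show ?thesis by (simp add: mult.assoc[symmetric])
      qed
      also have "\<dots> \<le> exp (- \<gamma> * v) * tail \<rho> (w - v)"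
        using k gamma_pos by (intro mult_mono tail_antimono rd) (auto simp: tail_bounds rd)
      finally show "- \<delta> * tail \<mu> w \<le> drift \<rho> v w"
        using 1 unfolding drift_def by (simp add: algebra_simps)
    qed
  qed
qed

text \<open>Cocycle identity: drifts are discounted increments of
  \<open>exp (\<gamma> * x) * tail \<rho> x\<close>, so consecutive steps add up. It cuts one long
  step into pieces.\<close>

lemma drift_add: "drift \<rho> (a + b) x = drift \<rho> a x + exp (- \<gamma> * a) * drift \<rho> b (x - a)"
proof -
  have "tail \<rho> (x - (a + b)) = tail \<rho> (x - a - b)" by (simp add: diff_diff_eq)
  then show ?thesis by (simp add: drift_def ring_distribs right_diff_distrib exp_add exp_diff exp_minus field_simps)
qed

text \<open>The drift of \<open>\<rho> \<star> \<sigma>\<close> dominates the average of the drift of \<open>\<rho>\<close> over a window \<open>{-N..N}\<close> charged by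
  \<open>\<sigma>\<close>. A step of length \<open>a + 2 * N\<close> seen from any point of the window covers a step of length \<open>a\<close> from a
  common point, and the two remaining pieces contribute nonnegatively up to a small error.\<close>

lemma asymp_incr_factor:
  assumes dom: "dominated \<rho>" "dominated \<sigma>" and decr: "asymp_decr \<rho>" "asymp_decr \<sigma>"
    and incr: "asymp_incr (\<rho> \<star> \<sigma>)"
  shows "asymp_incr \<rho>"
  unfolding asymp_incr_def
proof (intro allI impI)
  fix a \<epsilon> :: real assume a: "0 \<le> a" and eps: "0 < \<epsilon>"
  note rd = dominated_real_distribution[OF dom(1)] dominated_real_distribution[OF dom(2)]
  interpret S: real_distribution \<sigma> by fact
  obtain \<kappa> where \<kappa>: "\<kappa> > 0" "\<And>x z. z \<ge> 0 \<Longrightarrow> tail \<mu> (x - z) \<le> exp (\<kappa> * (z + 1)) * tail \<mu> x"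
    by (rule tail_mu_shift) blast
  define C where "C = exp (\<kappa> * (a + 1))"
  have C: "C > 0" by (simp add: C_def)
  obtain N where N: "N > 0" "measure \<sigma> {-N..N} > 0"
  proof -
    have "(\<lambda>n. measure \<sigma> {- real n..real n}) \<longlonglongrightarrow> measure \<sigma> (\<Union>n. {- real n..real n})"
      by (intro S.finite_Lim_measure_incseq) (auto simp: incseq_def)
    also have "(\<Union>n. {- real n..real n}) = UNIV"
    proof -
      have "\<exists>n. x \<in> {- real n..real n}" for x
      proof -
        obtain n where "\<bar>x\<bar> \<le> real n" using real_arch_simple by blast
        then show ?thesis by (intro exI[of _ n]) auto
      qed
      then show ?thesis by blast
    qed
    finally have "(\<lambda>n. measure \<sigma> {- real n..real n}) \<longlonglongrightarrow> 1" using S.prob_space by simp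
    then have "eventually (\<lambda>n. measure \<sigma> {- real n..real n} > 0 \<and> n > 0) sequentially"
      by (intro eventually_conj order_tendstoD(1)[of _ 1] eventually_gt_at_top) auto
    then obtain n where "measure \<sigma> {- real n..real n} > 0" "n > 0"
      by (auto simp: eventually_sequentially)
    then show ?thesis using that[of "real n"] by auto
  qed
  define p where "p = measure \<sigma> {-N..N}"
  have p: "p > 0" using N by (simp add: p_def)
  \<comment> \<open>\<open>2 / p\<close> comes from averaging over the window, \<open>1\<close> and
    \<open>C\<close> from the outer pieces of the long step, and
    \<open>exp (2 * \<gamma> * N)\<close> undoes the strongest discount of the middle piece.\<close>
  define Q where "Q = exp (2 * \<gamma> * N) * (2 / p + 1 + C)"
  have Q: "Q > 0" using p C by (auto simp: Q_def intro!: mult_pos_pos add_pos_pos)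
  define \<delta> where "\<delta> = \<epsilon> / Q"
  have \<delta>: "\<delta> > 0" "Q * \<delta> = \<epsilon>" using Q eps by (auto simp: \<delta>_def)
  define a' where "a' = a + 2 * N"
  have a': "a' \<ge> 0" using a N by (simp add: a'_def)
  have "\<forall>\<^sub>F x in at_top. drift (\<rho> \<star> \<sigma>) a' x \<le> \<delta> * tail \<mu> x"
    using incr a' \<delta> unfolding asymp_incr_def by blast
  moreover have "\<forall>\<^sub>F x in at_top. drift (\<rho> \<star> \<sigma>) a' x \<ge>
      (LINT y|\<sigma>. indicator {-N..N} y * drift \<rho> a' (x - y)) - \<delta> * tail \<mu> x"
    by (rule drift_convolution_ge[OF dom decr a' \<delta>(1)])
  ultimately have "\<forall>\<^sub>F x in at_top. (LINT y|\<sigma>. indicator {-N..N} y * drift \<rho> a' (x - y)) \<le> 2 * \<delta> * tail \<mu> x"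
    by eventually_elim linarith
  then obtain x1 where x1: "\<And>x. x \<ge> x1 \<Longrightarrow> (LINT y|\<sigma>. indicator {-N..N} y * drift \<rho> a' (x - y)) \<le> 2 * \<delta> * tail \<mu> x"
    by (auto simp: eventually_at_top_linorder)
  from asymp_decr_uniform[OF dom(1) decr(1) \<delta>(1), of "2 * N"] obtain x2 where
    "\<forall>w\<ge>x2. \<forall>v\<in>{0..2 * N}. - \<delta> * tail \<mu> w \<le> drift \<rho> v w"
    unfolding eventually_at_top_linorder by blast
  then have x2: "\<And>w v. w \<ge> x2 \<Longrightarrow> 0 \<le> v \<Longrightarrow> v \<le> 2 * N \<Longrightarrow> - \<delta> * tail \<mu> w \<le> drift \<rho> v w"
    by simp
  have "drift \<rho> a x \<le> \<epsilon> * tail \<mu> x" if x: "x \<ge> max x1 (x2 + a)" for x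
  proof (cases "drift \<rho> a x \<le> 0")
    case True
    then show ?thesis using eps tail_mu_pos[of x] by (smt (verit) mult_pos_pos)
  next
    case False
    define L where "L = exp (- (2 * \<gamma> * N)) * drift \<rho> a x - \<delta> * (1 + C) * tail \<mu> x"
    have L: "L \<le> drift \<rho> a' (x + N - y)" if y: "y \<in> {-N..N}" for y
    proof -
      define v where "v = N - y"
      have v: "0 \<le> v" "v \<le> 2 * N" using y by (auto simp: v_def)
      \<comment> \<open>From \<open>x + v\<close> down to \<open>x\<close>, then the step of
        interest down to \<open>x - a\<close>, then the rest.\<close>
      have "a' = v + (a + (2 * N - v))" by (simp add: a'_def)
      then have "drift \<rho> a' (x + v) = drift \<rho> v (x + v) + exp (- \<gamma> * v) * (drift \<rho> a x +
        exp (- \<gamma> * a) * drift \<rho> (2 * N - v) (x - a))"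
        by (simp only: drift_add) simp
      moreover have "- \<delta> * tail \<mu> x \<le> drift \<rho> v (x + v)"
        using x2[of "x + v" v] v x a tail_antimono[OF real_distribution_mu, of x "x + v"] \<delta>(1)
        by (smt (verit) mult_left_mono mult_minus_left)
      moreover have "- (\<delta> * C * tail \<mu> x) \<le> exp (- \<gamma> * v) * (exp (- \<gamma> * a) * drift \<rho> (2 * N - v) (x - a))"
      proof -
        have "- (\<delta> * C * tail \<mu> x) \<le> - \<delta> * tail \<mu> (x - a)"
          using \<kappa>(2)[OF a, of x] \<delta>(1) by (simp add: C_def mult.assoc)
        moreover have "- \<delta> * tail \<mu> (x - a) \<le> exp (- \<gamma> * (v + a)) * (- \<delta> * tail \<mu> (x - a))"
          using v a gamma_pos \<delta>(1) tail_mu_pos[of "x - a"] by (simp add: mult_left_le_one_le)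
        moreover have "\<dots> \<le> exp (- \<gamma> * (v + a)) * drift \<rho> (2 * N - v) (x - a)"
          using x2[of "x - a" "2 * N - v"] v x by (intro mult_left_mono) auto
        moreover have "exp (- \<gamma> * (v + a)) = exp (- \<gamma> * v) * exp (- \<gamma> * a)"
          by (simp add: ring_distribs exp_diff exp_minus field_simps)
        ultimately show ?thesis by (simp add: mult.assoc)
      qed
      \<comment> \<open>Positivity of \<open>drift \<rho> a x\<close>, from the case distinction,
        lets the discount be replaced by its smallest value over the window.\<close>
      moreover have "exp (- (2 * \<gamma> * N)) * drift \<rho> a x \<le> exp (- \<gamma> * v) * drift \<rho> a x"
        using v False gamma_pos by (intro mult_right_mono) auto
      ultimately show ?thesis
        unfolding L_def v_def by (simp add: algebra_simps)
    qed
    \<comment> \<open>The window is viewed from \<open>x + N\<close>, so that all its points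
      \<open>x + N - y\<close> lie at or above \<open>x\<close>; averaging the bound
      \<open>L\<close> over it gives \<open>p * L\<close>.\<close>
    have "p * L = (LINT y|\<sigma>. indicator {-N..N} y * L)" by (simp add: p_def)
    also have "\<dots> \<le> (LINT y|\<sigma>. indicator {-N..N} y * drift \<rho> a' (x + N - y))"
    proof (rule integral_mono)
      show "integrable \<sigma> (\<lambda>y. indicator {-N..N} y * drift \<rho> a' (x + N - y))"
        using abs_drift_le[OF rd(1) a'] borel_measurable_drift[OF rd(1), of a']
        by (intro integrable_bounded_real_distribution[OF rd(2), where B=1]) (auto split: split_indicator)
      show "integrable \<sigma> (\<lambda>y. indicator {-N..N} y * L)"
        by (intro integrable_bounded_real_distribution[OF rd(2), where B="\<bar>L\<bar>"]) (auto split: split_indicator)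
    qed (use L in \<open>auto split: split_indicator\<close>)
    also have "\<dots> \<le> 2 * \<delta> * tail \<mu> (x + N)" using x1[of "x + N"] x N by simp
    also have "\<dots> \<le> 2 * \<delta> * tail \<mu> x"
      using \<delta>(1) N by (intro mult_left_mono tail_antimono real_distribution_mu) auto
    finally have "L \<le> (2 / p) * \<delta> * tail \<mu> x" using p by (simp add: field_simps)
    then have "exp (- (2 * \<gamma> * N)) * drift \<rho> a x \<le> (2 / p + 1 + C) * \<delta> * tail \<mu> x"
      by (simp add: L_def algebra_simps)
    then have "exp (2 * \<gamma> * N) * (exp (- (2 * \<gamma> * N)) * drift \<rho> a x) \<le>
        exp (2 * \<gamma> * N) * ((2 / p + 1 + C) * \<delta> * tail \<mu> x)"
      by (intro mult_left_mono) auto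
    then show ?thesis unfolding \<delta>(2)[symmetric] Q_def
      by (simp add: mult.assoc[symmetric] flip: exp_add)
  qed
  then show "\<forall>\<^sub>F x in at_top. drift \<rho> a x \<le> \<epsilon> * tail \<mu> x"
    unfolding eventually_at_top_linorder by blast
qed

text \<open>A moment of rate \<open>\<kappa> + 1\<close> beats the decay rate
  \<open>\<kappa>\<close> of \<open>tail \<mu>\<close> by a factor \<open>exp (- x)\<close>.\<close>

lemma light_tailed_bound:
  assumes "light_tailed \<sigma>"
  obtains C where "C > 0" "\<And>x. x \<ge> 0 \<Longrightarrow> tail \<sigma> x \<le> C * exp (- x) * tail \<mu> x"
proof -
  obtain \<kappa> where \<kappa>: "\<kappa> > 0" "\<And>x z. z \<ge> 0 \<Longrightarrow> tail \<mu> (x - z) \<le> exp (\<kappa> * (z + 1)) * tail \<mu> x"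
    by (rule tail_mu_shift) blast
  have rd: "real_distribution \<sigma>" and int: "integrable \<sigma> (\<lambda>x. exp ((\<kappa> + 1) * x))"
    using assms \<kappa>(1) by (auto simp: light_tailed_def)
  define E where "E = (LINT y|\<sigma>. exp ((\<kappa> + 1) * y))"
  have E: "E \<ge> 0" by (simp add: E_def)
  have "tail \<sigma> x \<le> ((E + 1) * exp \<kappa> / tail \<mu> 0) * exp (- x) * tail \<mu> x" if x: "x \<ge> 0" for x
  proof -
    have "tail \<sigma> x \<le> exp (- (\<kappa> + 1) * x) * E"
      unfolding E_def by (rule tail_le_exp_moment) (use rd int \<kappa> in auto)
    also have "\<dots> \<le> exp (- (\<kappa> + 1) * x) * ((E + 1) * (exp (\<kappa> * (x + 1)) * tail \<mu> x / tail \<mu> 0))"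
    proof (intro mult_left_mono)
      have "1 \<le> exp (\<kappa> * (x + 1)) * tail \<mu> x / tail \<mu> 0"
        using \<kappa>(2)[OF x, of x] tail_mu_pos[of 0] by (simp add: field_simps)
      then show "E \<le> (E + 1) * (exp (\<kappa> * (x + 1)) * tail \<mu> x / tail \<mu> 0)"
        using E mult_mono[of E "E + 1" 1 "exp (\<kappa> * (x + 1)) * tail \<mu> x / tail \<mu> 0"] by simp
    qed auto
    also have "\<dots> = (E + 1) / tail \<mu> 0 * (exp (- (\<kappa> + 1) * x) * exp (\<kappa> * (x + 1))) * tail \<mu> x"
      by (simp add: field_simps)
    also have "exp (- (\<kappa> + 1) * x) * exp (\<kappa> * (x + 1)) = exp \<kappa> * exp (- x)"
      by (simp add: algebra_simps flip: exp_add)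
    finally show ?thesis by (simp add: mult_ac)
  qed
  moreover have "(E + 1) * exp \<kappa> / tail \<mu> 0 > 0" using E tail_mu_pos[of 0] by simp
  ultimately show ?thesis using that by blast
qed

lemma light_tailed_dominated:
  assumes "light_tailed \<sigma>"
  shows "dominated \<sigma>"
proof -
  have rd: "real_distribution \<sigma>" using assms by (simp add: light_tailed_def)
  obtain C where C: "C > 0" "\<And>x. x \<ge> 0 \<Longrightarrow> tail \<sigma> x \<le> C * exp (- x) * tail \<mu> x"
    by (rule light_tailed_bound[OF assms]) blast
  have "tail \<sigma> x \<le> (C + 1 / tail \<mu> 0) * tail \<mu> x" for x
  proof (cases "x \<ge> 0")
    case True
    have "tail \<sigma> x \<le> C * exp (- x) * tail \<mu> x" using C True by blast
    also have "\<dots> \<le> C * 1 * tail \<mu> x"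
      using C True tail_mu_pos[of x] by (intro mult_mono mult_left_mono) auto
    also have "\<dots> \<le> (C + 1 / tail \<mu> 0) * tail \<mu> x"
      using tail_mu_pos[of 0] tail_mu_pos[of x] by (intro mult_right_mono) auto
    finally show ?thesis .
  next
    case False
    have "tail \<sigma> x \<le> 1 / tail \<mu> 0 * tail \<mu> 0" using tail_bounds[OF rd] tail_mu_pos[of 0] by simp
    also have "\<dots> \<le> (C + 1 / tail \<mu> 0) * tail \<mu> x"
      using C False tail_mu_pos[of 0]
      by (intro mult_mono tail_antimono real_distribution_mu) auto
    finally show ?thesis .
  qed
  then show ?thesis unfolding dominated_def using rd by blast
qed

text \<open>The only negative term of the drift is \<open>- tail \<sigma> x\<close>, which is of
  smaller order than \<open>tail \<mu> x\<close>.\<close>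

lemma light_tailed_asymp_decr:
  assumes "light_tailed \<sigma>"
  shows "asymp_decr \<sigma>"
  unfolding asymp_decr_def
proof (intro allI impI)
  fix a \<epsilon> :: real assume a: "0 \<le> a" and eps: "0 < \<epsilon>"
  have rd: "real_distribution \<sigma>" using assms by (simp add: light_tailed_def)
  obtain C where C: "C > 0" "\<And>x. x \<ge> 0 \<Longrightarrow> tail \<sigma> x \<le> C * exp (- x) * tail \<mu> x"
    by (rule light_tailed_bound[OF assms]) blast
  have "((\<lambda>x::real. C * exp (- x)) \<longlongrightarrow> C * 0) at_top"
    by (intro tendsto_intros filterlim_compose[OF exp_at_bot filterlim_uminus_at_bot_at_top])
  then have "\<forall>\<^sub>F x in at_top. C * exp (- x) < \<epsilon>"
    by (rule order_tendstoD(2)) (use eps in simp)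
  then show "\<forall>\<^sub>F x in at_top. - \<epsilon> * tail \<mu> x \<le> drift \<sigma> a x"
    using eventually_ge_at_top[of 0]
  proof eventually_elim
    case (elim x)
    have "tail \<sigma> x \<le> C * exp (- x) * tail \<mu> x" using C elim by blast
    also have "\<dots> \<le> \<epsilon> * tail \<mu> x" using elim tail_mu_pos[of x] by (intro mult_right_mono) auto
    finally have "tail \<sigma> x \<le> \<epsilon> * tail \<mu> x" .
    moreover have "0 \<le> exp (- \<gamma> * a) * tail \<sigma> (x - a)" by (simp add: tail_bounds rd)
    ultimately show ?case unfolding drift_def by linarith
  qed
qed

text \<open>Convolving with a light law amounts to a bounded shift up to a small error: summands
  \<open>y <= c\<close> shift by at most \<open>c\<close>, and those above \<open>c\<close> are paid
  for by an exponential moment. This serves to strip \<open>Z 1\<close> off in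
  \<open>tail_mu_le_tail_M\<close>.\<close>

lemma tail_convolution_light_le:
  assumes dom: "dominated \<rho>" and light: "light_tailed \<sigma>" and \<delta>: "\<delta> > 0"
  obtains c where "c \<ge> 0" "\<And>x. tail (\<rho> \<star> \<sigma>) x \<le> tail \<rho> (x - c) + \<delta> * tail \<mu> x"
proof -
  obtain \<kappa> where \<kappa>: "\<kappa> > 0" "\<And>x z. z \<ge> 0 \<Longrightarrow> tail \<mu> (x - z) \<le> exp (\<kappa> * (z + 1)) * tail \<mu> x"
    by (rule tail_mu_shift) blast
  have rd: "real_distribution \<rho>" "real_distribution \<sigma>"
    and int: "integrable \<sigma> (\<lambda>x. exp ((\<kappa> + 1) * x))"
    using light \<kappa>(1) dominated_real_distribution[OF dom] by (auto simp: light_tailed_def)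
  interpret S: real_distribution \<sigma> by fact
  note [measurable] = borel_measurable_tail[OF rd(1)]
  obtain C where C: "C > 0" "\<And>x. tail \<rho> x \<le> C * tail \<mu> x" by (rule dominatedE[OF dom]) blast
  define E where "E = (LINT y|\<sigma>. exp ((\<kappa> + 1) * y))"
  have E: "E \<ge> 0" by (simp add: E_def)
  have "((\<lambda>c::real. C * exp \<kappa> * E * exp (- c)) \<longlongrightarrow> C * exp \<kappa> * E * 0) at_top"
    by (intro tendsto_intros filterlim_compose[OF exp_at_bot filterlim_uminus_at_bot_at_top])
  then have "\<forall>\<^sub>F c in at_top. C * exp \<kappa> * E * exp (- c) < \<delta>"
    by (rule order_tendstoD(2)) (use \<delta> in simp)
  then have "\<forall>\<^sub>F c in at_top. C * exp \<kappa> * E * exp (- c) < \<delta> \<and> 0 \<le> c"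
    using eventually_ge_at_top[of 0] by (rule eventually_conj)
  then obtain c where c: "C * exp \<kappa> * E * exp (- c) < \<delta>" "0 \<le> c"
    by (auto simp: eventually_at_top_linorder)
  have "tail (\<rho> \<star> \<sigma>) x \<le> tail \<rho> (x - c) + \<delta> * tail \<mu> x" for x
  proof -
    define B where "B = C * exp \<kappa> * exp (- c) * tail \<mu> x"
    have B: "B \<ge> 0" using C tail_mu_pos[of x] by (simp add: B_def)
    have "(LINT y|\<sigma>. tail \<rho> (x - y)) \<le> (LINT y|\<sigma>. tail \<rho> (x - c) + B * exp ((\<kappa> + 1) * y))"
    proof (rule integral_mono)
      fix y
      show "tail \<rho> (x - y) \<le> tail \<rho> (x - c) + B * exp ((\<kappa> + 1) * y)"
      proof (cases "y \<le> c")
        case True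
        then have "tail \<rho> (x - y) \<le> tail \<rho> (x - c)" by (intro tail_antimono rd) auto
        then show ?thesis using B by (smt (verit) exp_ge_zero mult_nonneg_nonneg)
      next
        case False
        have "tail \<rho> (x - y) \<le> C * tail \<mu> (x - y)" by (rule C)
        also have "\<dots> \<le> C * (exp (\<kappa> * (y + 1)) * tail \<mu> x)"
          using C \<kappa> False c by (intro mult_left_mono) auto
        \<comment> \<open>Since \<open>y > c\<close>, adding \<open>y - c\<close> to the exponent
          only enlarges it; this produces the factor \<open>exp (- c)\<close>.\<close>
        also have "\<dots> \<le> C * (exp (\<kappa> + ((\<kappa> + 1) * y - c)) * tail \<mu> x)"
          using C False tail_mu_pos[of x] by (intro mult_left_mono mult_right_mono) (auto simp: algebra_simps)
        also have "\<dots> = B * exp ((\<kappa> + 1) * y)"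
          by (simp add: B_def exp_add exp_diff exp_minus field_simps)
        finally show ?thesis using tail_bounds[OF rd(1), of "x - c"] by linarith
      qed
    qed (use int in \<open>auto intro!: integrable_bounded_real_distribution[OF rd(2), where B=1] simp: tail_bounds rd\<close>)
    also have "\<dots> = tail \<rho> (x - c) + B * E"
      using int S.prob_space by (simp add: E_def)
    also have "B * E = (C * exp \<kappa> * E * exp (- c)) * tail \<mu> x" by (simp add: B_def)
    also have "\<dots> \<le> \<delta> * tail \<mu> x" using c tail_mu_pos[of x] by (intro mult_right_mono) auto
    finally show ?thesis by (simp add: tail_convolution rd)
  qed
  then show ?thesis using that c by blast
qed

end

subsection \<open>Compound Poisson factor times light-tailed factor\<close>

text \<open>What the argument uses of the Levy structure. \<open>rho_decr\<close> is the hypothesis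
  on nu_1 cleared of its denominator; its error is relative to \<open>tail \<rho>\<close> and
  becomes one relative to \<open>tail \<mu>\<close> once \<open>\<rho>\<close> is known to be
  dominated.\<close>

locale levy_factorisation = convolution_dominating +
  fixes M CP Z :: "real \<Rightarrow> real measure" and \<rho> :: "real measure" and r :: real
  assumes r_pos: "r > 0"
    and rd_rho: "real_distribution \<rho>"
    and M_1: "M 1 = \<mu>"
    and M_add: "\<And>s t. s > 0 \<Longrightarrow> t > 0 \<Longrightarrow> M (s + t) = (M s \<star> M t)"
    and M_eq: "\<And>t. t > 0 \<Longrightarrow> M t = (CP t \<star> Z t)"
    and rd_CP: "\<And>t. t > 0 \<Longrightarrow> real_distribution (CP t)"
    and CP_sums: "\<And>t x. t > 0 \<Longrightarrow>
      (\<lambda>n. exp (- (r * t)) * (r * t) ^ n / fact n * tail (conv_power \<rho> n) x) sums tail (CP t) x"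
    and light_Z: "\<And>t. t > 0 \<Longrightarrow> light_tailed (Z t)"
    and rho_decr: "\<And>a \<epsilon>. a \<ge> 0 \<Longrightarrow> \<epsilon> > 0 \<Longrightarrow>
      \<forall>\<^sub>F x in at_top. (1 - \<epsilon>) * tail \<rho> x \<le> exp (- \<gamma> * a) * tail \<rho> (x - a)"
begin

definition weight :: "real \<Rightarrow> nat \<Rightarrow> real" where
  "weight t n = exp (- (r * t)) * (r * t) ^ n / fact n"

lemma weight_pos: "t > 0 \<Longrightarrow> weight t n > 0"
  using r_pos by (simp add: weight_def)

lemma CP_sums': "t > 0 \<Longrightarrow> (\<lambda>n. weight t n * tail (conv_power \<rho> n) x) sums tail (CP t) x"
  using CP_sums unfolding weight_def by blast

lemma rd_power: "real_distribution (conv_power \<rho> n)"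
  by (rule real_distribution_conv_power[OF rd_rho])

lemma rd_Z: "t > 0 \<Longrightarrow> real_distribution (Z t)"
  using light_Z by (simp add: light_tailed_def)

lemma rd_M: "t > 0 \<Longrightarrow> real_distribution (M t)"
  by (simp add: M_eq real_distribution_convolution rd_CP rd_Z)

text \<open>Integer times are convolution powers of \<open>\<mu>\<close>; any other
  \<open>M t\<close> is a factor of a later integer time.\<close>

lemma dominated_M:
  assumes t: "t > 0"
  shows "dominated (M t)"
proof -
  have nat: "dominated (M (real (Suc n)))" for n
  proof (induction n)
    case 0
    then show ?case by (simp add: M_1 dominated_mu)
  next
    case (Suc n)
    have "M (real (Suc (Suc n))) = (M (real (Suc n)) \<star> M 1)"
      using M_add[of "real (Suc n)" 1] by (simp add: algebra_simps)
    then show ?case using dominated_convolution[OF Suc] by (simp add: M_1 dominated_mu)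
  qed
  obtain n where n: "t < real n" using reals_Archimedean2 by blast
  then have "n = Suc (n - 1)" using t by (cases n) auto
  with nat[of "n - 1"] have "dominated (M (real n))" by simp
  moreover have "M (real n) = (M t \<star> M (real n - t))" using M_add[of t "real n - t"] n t by simp
  ultimately show ?thesis using dominated_factor rd_M t n by (metis diff_gt_0_iff_gt)
qed

lemma dominated_CP: "t > 0 \<Longrightarrow> dominated (CP t)"
  using dominated_factor[of "CP t" "Z t"] dominated_M[of t] by (simp add: M_eq rd_CP rd_Z)

lemma weight_tail_le:
  assumes "t > 0"
  shows "(\<Sum>n<N. weight t n * tail (conv_power \<rho> n) x) \<le> tail (CP t) x"
    and "weight t n * tail (conv_power \<rho> n) x \<le> tail (CP t) x"
proof -
  have sm: "summable (\<lambda>n. weight t n * tail (conv_power \<rho> n) x)"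
    and eq: "(\<Sum>n. weight t n * tail (conv_power \<rho> n) x) = tail (CP t) x"
    using CP_sums'[OF assms] by (auto simp: sums_iff)
  have nn: "0 \<le> weight t n * tail (conv_power \<rho> n) x" for n
    using weight_pos[OF assms, of n] tail_bounds[OF rd_power, of n x] by simp
  show "(\<Sum>n<N. weight t n * tail (conv_power \<rho> n) x) \<le> tail (CP t) x"
    unfolding eq[symmetric] by (intro sum_le_suminf sm) (auto simp: nn)
  have "(\<Sum>k\<in>{n}. weight t k * tail (conv_power \<rho> k) x) \<le> tail (CP t) x"
    unfolding eq[symmetric] by (intro sum_le_suminf sm) (auto simp: nn)
  then show "weight t n * tail (conv_power \<rho> n) x \<le> tail (CP t) x" by simp
qed

text \<open>The \<open>n\<close>-th power is one term, with positive weight, of the Poisson series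
  of \<open>CP 1\<close>.\<close>

lemma dominated_power: "dominated (conv_power \<rho> n)"
proof -
  obtain C where C: "C > 0" "\<And>x. tail (CP 1) x \<le> C * tail \<mu> x"
    by (rule dominatedE[OF dominated_CP[of 1]]) auto
  have "tail (conv_power \<rho> n) x \<le> (C / weight 1 n) * tail \<mu> x" for x
    using weight_tail_le(2)[of 1 n x] C(2)[of x] weight_pos[of 1 n] by (simp add: field_simps)
  then show ?thesis unfolding dominated_def using rd_power by blast
qed

lemma asymp_decr_power: "asymp_decr (conv_power \<rho> n)"
proof (induction n)
  case 0
  have "tail (return borel 0) x = 0" if "x \<ge> 0" for x :: real
    using that by (simp add: tail_def measure_return)
  then have "- \<epsilon> * tail \<mu> x \<le> drift (return borel 0) a x" if "x \<ge> 0" "\<epsilon> > 0" for x a \<epsilon> :: real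
    using that tail_mu_pos[of x] tail_bounds[OF real_distribution_return_borel]
    by (smt (verit) drift_def exp_ge_zero mult_minus_left mult_nonneg_nonneg)
  then show ?case unfolding asymp_decr_def by (auto simp: eventually_at_top_linorder)
next
  case (Suc n)
  have dom: "dominated \<rho>"
  proof -
    have "conv_power \<rho> 1 = \<rho>"
      by (rule Levy_uniqueness[OF rd_power rd_rho]) (simp add: fun_eq_iff char_convolution
        char_return_borel rd_rho real_distribution_return_borel)
    then show ?thesis using dominated_power[of 1] by simp
  qed
  obtain C where C: "C > 0" "\<And>x. tail \<rho> x \<le> C * tail \<mu> x" by (rule dominatedE[OF dom]) blast
  have "asymp_decr \<rho>" unfolding asymp_decr_def
  proof (intro allI impI)
    fix a \<epsilon> :: real assume a: "0 \<le> a" and eps: "0 < \<epsilon>"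
    \<comment> \<open>Dividing by the domination constant converts the relative error into one in
      \<open>tail \<mu>\<close>.\<close>
    have "\<forall>\<^sub>F x in at_top. (1 - \<epsilon> / C) * tail \<rho> x \<le> exp (- \<gamma> * a) * tail \<rho> (x - a)"
      using a eps C by (intro rho_decr) auto
    then show "\<forall>\<^sub>F x in at_top. - \<epsilon> * tail \<mu> x \<le> drift \<rho> a x"
    proof eventually_elim
      case (elim x)
      have "\<epsilon> / C * tail \<rho> x \<le> \<epsilon> / C * (C * tail \<mu> x)"
        using C eps by (intro mult_left_mono) auto
      then show ?case using elim C by (simp add: drift_def algebra_simps)
    qed
  qed
  then show ?case
    using Suc asymp_decr_convolution[OF dom dominated_power] by simp
qed

text \<open>The Poisson weights of order \<open>n\<close> at times \<open>t\<close> and \<open>2 t\<close> differ by a factor \<open>2 ^ n\<close>. This bounds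
  the remainder of the series by a convolution power of \<open>\<mu>\<close>, without Kesten's bound for \<open>\<rho>\<close>.\<close>

lemma CP_remainder:
  assumes t: "t > 0"
  shows "tail (CP t) x \<le> (\<Sum>n<N. weight t n * tail (conv_power \<rho> n) x) +
    (1 / 2) ^ N * exp (r * t) * tail (CP (2 * t)) x"
proof -
  have w: "weight t n = (1 / 2) ^ n * exp (r * t) * weight (2 * t) n" for n
  proof -
    have "exp (- (r * t)) = exp (r * t) * exp (- (r * (2 * t)))"
      by (simp flip: exp_add)
    moreover have "(r * t) ^ n = (1 / 2) ^ n * (r * (2 * t)) ^ n"
      by (simp flip: power_mult_distrib)
    ultimately show ?thesis by (simp add: weight_def)
  qed
  let ?a = "\<lambda>n. tail (conv_power \<rho> n) x"
  have upper: "(\<lambda>n. (if n \<in> {..<N} then weight t n * ?a n else 0) +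
      (1 / 2) ^ N * exp (r * t) * (weight (2 * t) n * ?a n)) sums
    ((\<Sum>n<N. weight t n * ?a n) + (1 / 2) ^ N * exp (r * t) * tail (CP (2 * t)) x)"
    by (intro sums_add sums_If_finite_set sums_mult CP_sums') (use t in auto)
  have "weight t n * ?a n \<le> (if n \<in> {..<N} then weight t n * ?a n else 0) +
      (1 / 2) ^ N * exp (r * t) * (weight (2 * t) n * ?a n)" for n
  proof -
    have nn: "0 \<le> exp (r * t) * (weight (2 * t) n * ?a n)"
      using weight_pos[of "2 * t" n] t tail_bounds[OF rd_power, of n x] by simp
    show ?thesis
    proof (cases "n < N")
      case False
      have "(1 / 2) ^ n * (exp (r * t) * (weight (2 * t) n * ?a n)) \<le>
          (1 / 2) ^ N * (exp (r * t) * (weight (2 * t) n * ?a n))"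
        using False by (intro mult_right_mono nn power_decreasing) auto
      then show ?thesis using False by (simp add: w mult_ac)
    qed (use mult_nonneg_nonneg[OF _ nn, of "(1 / 2) ^ N"] in \<open>simp add: mult.assoc\<close>)
  qed
  then show ?thesis by (rule sums_le[OF _ CP_sums'[OF t] upper])
qed

text \<open>Only finitely many powers can share a threshold, so the series is truncated: at
  \<open>x - a\<close> the partial sum is a lower bound for the tail, and at \<open>x\<close> the
  remainder is paid for by \<open>CP_remainder\<close>.\<close>

lemma asymp_decr_CP:
  assumes t: "t > 0"
  shows "asymp_decr (CP t)"
  unfolding asymp_decr_def
proof (intro allI impI)
  fix a \<epsilon> :: real assume a: "0 \<le> a" and eps: "0 < \<epsilon>"
  obtain C where C: "C > 0" "\<And>x. tail (CP (2 * t)) x \<le> C * tail \<mu> x"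
    by (rule dominatedE[OF dominated_CP[of "2 * t"]]) (use t in auto)
  obtain N where N: "(1 / 2) ^ N < \<epsilon> / (2 * (exp (r * t) * C))"
    using real_arch_pow_inv[of "\<epsilon> / (2 * (exp (r * t) * C))" "1/2"] eps C by auto
  define W where "W = (\<Sum>n<N. weight t n)"
  have W: "W \<ge> 0" unfolding W_def by (intro sum_nonneg less_imp_le weight_pos t)
  define \<delta> where "\<delta> = \<epsilon> / (2 * (W + 1))"
  have \<delta>: "\<delta> > 0" using eps W by (simp add: \<delta>_def)
  have \<delta>W: "W * \<delta> \<le> \<epsilon> / 2" using eps W by (simp add: \<delta>_def field_simps)
  have "\<forall>\<^sub>F x in at_top. \<forall>n\<in>{..<N}. - \<delta> * tail \<mu> x \<le> drift (conv_power \<rho> n) a x"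
    using asymp_decr_power a \<delta> unfolding asymp_decr_def
    by (intro eventually_ball_finite ballI) blast+
  then show "\<forall>\<^sub>F x in at_top. - \<epsilon> * tail \<mu> x \<le> drift (CP t) a x"
  proof eventually_elim
    case (elim x)
    have "W * (- \<delta> * tail \<mu> x) = (\<Sum>n<N. weight t n * (- \<delta> * tail \<mu> x))"
      by (simp add: W_def sum_distrib_right sum_negf)
    also have "\<dots> \<le> (\<Sum>n<N. weight t n * drift (conv_power \<rho> n) a x)"
      using elim by (intro sum_mono mult_left_mono) (auto simp: less_imp_le[OF weight_pos[OF t]])
    also have "\<dots> = exp (- \<gamma> * a) * (\<Sum>n<N. weight t n * tail (conv_power \<rho> n) (x - a)) -
        (\<Sum>n<N. weight t n * tail (conv_power \<rho> n) x)"
      by (simp add: drift_def sum_distrib_left sum_subtractf algebra_simps)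
    finally have 1: "W * (- \<delta> * tail \<mu> x) \<le>
        exp (- \<gamma> * a) * (\<Sum>n<N. weight t n * tail (conv_power \<rho> n) (x - a)) -
        (\<Sum>n<N. weight t n * tail (conv_power \<rho> n) x)" .
    have 2: "exp (- \<gamma> * a) * (\<Sum>n<N. weight t n * tail (conv_power \<rho> n) (x - a)) \<le>
        exp (- \<gamma> * a) * tail (CP t) (x - a)"
      by (intro mult_left_mono weight_tail_le t) auto
    have "(1 / 2) ^ N * exp (r * t) * tail (CP (2 * t)) x \<le> (1 / 2) ^ N * exp (r * t) * (C * tail \<mu> x)"
      using C by (intro mult_left_mono) auto
    also have "\<dots> = (1 / 2) ^ N * (exp (r * t) * C * tail \<mu> x)" by simp
    also have "\<dots> \<le> \<epsilon> / (2 * (exp (r * t) * C)) * (exp (r * t) * C * tail \<mu> x)"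
      using N C tail_mu_pos[of x] by (intro mult_right_mono) auto
    also have "\<dots> = \<epsilon> / 2 * tail \<mu> x" using C by simp
    finally have 3: "(1 / 2) ^ N * exp (r * t) * tail (CP (2 * t)) x \<le> \<epsilon> / 2 * tail \<mu> x" .
    have "W * \<delta> * tail \<mu> x \<le> \<epsilon> / 2 * tail \<mu> x"
      using \<delta>W tail_mu_pos[of x] by (intro mult_right_mono) auto
    moreover have "W * (- \<delta> * tail \<mu> x) = - (W * \<delta> * tail \<mu> x)" by simp
    moreover have "\<epsilon> * tail \<mu> x = \<epsilon> / 2 * tail \<mu> x + \<epsilon> / 2 * tail \<mu> x" by simp
    ultimately show ?case
      using 1 2 3 CP_remainder[OF t, of x N] unfolding drift_def mult_minus_left by linarith
  qed
qed

lemma asymp_decr_M: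
  assumes "t > 0"
  shows "asymp_decr (M t)"
  unfolding M_eq[OF assms]
  by (intro asymp_decr_convolution dominated_CP asymp_decr_CP light_tailed_dominated
        light_tailed_asymp_decr light_Z assms)

text \<open>The weights of the first \<open>N\<close> powers at times \<open>1\<close> and
  \<open>s\<close> have bounded ratios, and the rest is a small multiple of \<open>CP 2\<close>.
  After convolution with \<open>Z 1\<close> this rest is at most half of \<open>tail \<mu>\<close>
  and is absorbed. Then \<open>Z 1\<close> is removed and \<open>Z s\<close> put in its place, at
  the cost of bounded shifts.\<close>

lemma tail_mu_le_tail_M:
  assumes s: "s > 0"
  obtains C where "C > 0" "\<And>x. tail \<mu> x \<le> C * tail (M s) x"
proof -
  have rZ: "real_distribution (Z 1)" by (rule rd_Z) simp
  have rCP: "real_distribution (CP 1)" "real_distribution (CP 2)" "real_distribution (CP s)"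
    using s by (auto intro: rd_CP)
  note [measurable] = borel_measurable_tail[OF rCP(1)] borel_measurable_tail[OF rCP(2)]
    borel_measurable_tail[OF rCP(3)]
  have "dominated (CP 2 \<star> Z 1)"
    by (intro dominated_convolution dominated_CP light_tailed_dominated light_Z) auto
  then obtain D where D: "D > 0" "\<And>x. tail (CP 2 \<star> Z 1) x \<le> D * tail \<mu> x"
    by (rule dominatedE) blast
  obtain N where N: "(1 / 2) ^ N < 1 / (2 * (exp r * D))"
    using real_arch_pow_inv[of "1 / (2 * (exp r * D))" "1/2"] D by auto
  define B where "B = (1 / 2) ^ N * exp r"
  have B: "B > 0" "B * D \<le> 1 / 2" using N D by (auto simp: B_def field_simps)
  define A where "A = (\<Sum>n<N. weight 1 n / weight s n)"
  have A: "A \<ge> 0" unfolding A_def using weight_pos s by (intro sum_nonneg) (simp add: less_imp_le)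
  have le: "tail (CP 1) y \<le> A * tail (CP s) y + B * tail (CP 2) y" for y
  proof -
    have "(\<Sum>n<N. weight 1 n * tail (conv_power \<rho> n) y) =
        (\<Sum>n<N. weight 1 n / weight s n * (weight s n * tail (conv_power \<rho> n) y))"
      using weight_pos[OF s] by (intro sum.cong refl) (simp add: less_imp_neq[symmetric])
    also have "\<dots> \<le> (\<Sum>n<N. weight 1 n / weight s n * tail (CP s) y)"
      using weight_pos s by (intro sum_mono mult_left_mono weight_tail_le) (auto simp: less_imp_le)
    also have "\<dots> = A * tail (CP s) y" by (simp add: A_def sum_distrib_right)
    finally show ?thesis using CP_remainder[of 1 y N] by (simp add: B_def)
  qed
  have i: "integrable (Z 1) (\<lambda>y. tail (CP t) (x - y))" if "t > 0" for t x
    using borel_measurable_tail[OF rd_CP[OF that]]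
    by (intro integrable_bounded_real_distribution[OF rZ, where B=1])
       (auto simp: tail_bounds rd_CP[OF that])
  have le2: "tail \<mu> x \<le> A * tail (CP s \<star> Z 1) x + 1 / 2 * tail \<mu> x" for x
  proof -
    have "tail \<mu> x = (LINT y|Z 1. tail (CP 1) (x - y))"
      using M_eq[of 1] M_1 by (simp add: tail_convolution rCP rZ)
    also have "\<dots> \<le> (LINT y|Z 1. A * tail (CP s) (x - y) + B * tail (CP 2) (x - y))"
      by (intro integral_mono i le Bochner_Integration.integrable_add integrable_mult_right)
         (use s in auto)
    also have "\<dots> = A * tail (CP s \<star> Z 1) x + B * tail (CP 2 \<star> Z 1) x"
      using i s by (simp add: tail_convolution rCP rZ)
    also have "B * tail (CP 2 \<star> Z 1) x \<le> B * (D * tail \<mu> x)"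
      using B D by (intro mult_left_mono) auto
    also have "\<dots> = (B * D) * tail \<mu> x" by simp
    also have "\<dots> \<le> 1 / 2 * tail \<mu> x" using B tail_mu_pos[of x] by (intro mult_right_mono) auto
    finally show ?thesis by simp
  qed
  \<comment> \<open>With \<open>1 / 2\<close> already absorbed, an error of at most
    \<open>1 / 4\<close> leaves a quarter of \<open>tail \<mu> x\<close> on the left; hence the
    factor \<open>4\<close> below.\<close>
  define \<delta> where "\<delta> = 1 / (4 * (A + 1))"
  have \<delta>: "\<delta> > 0" "A * \<delta> \<le> 1 / 4" using A by (auto simp: \<delta>_def field_simps)
  obtain c where c: "c \<ge> 0" "\<And>x. tail (CP s \<star> Z 1) x \<le> tail (CP s) (x - c) + \<delta> * tail \<mu> x"
    by (rule tail_convolution_light_le[OF dominated_CP[OF s] light_Z[of 1] \<delta>(1)]) auto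
  have le3: "tail \<mu> x \<le> 4 * A * tail (CP s) (x - c)" for x
  proof -
    have "A * tail (CP s \<star> Z 1) x \<le> A * (tail (CP s) (x - c) + \<delta> * tail \<mu> x)"
      using A c by (intro mult_left_mono) auto
    moreover have "A * \<delta> * tail \<mu> x \<le> 1 / 4 * tail \<mu> x"
      using \<delta> tail_mu_pos[of x] by (intro mult_right_mono) auto
    ultimately show ?thesis using le2[of x] by (simp add: algebra_simps)
  qed
  obtain d where d: "d > 0" "tail (Z s) (- d) > 0" by (rule ex_tail_pos[OF rd_Z[OF s]])
  define q where "q = tail (Z s) (- d)"
  have le4: "tail (CP s) (x - c) \<le> tail (M s) (x - c - d) / q" for x
    using tail_mult_le_tail_convolution[OF rCP(3) rd_Z[OF s], of "x - c" "- d"] d(2)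
    unfolding M_eq[OF s] q_def[symmetric] by (simp add: field_simps)
  obtain \<kappa> where \<kappa>: "\<kappa> > 0" "\<And>x z. z \<ge> 0 \<Longrightarrow> tail \<mu> (x - z) \<le> exp (\<kappa> * (z + 1)) * tail \<mu> x"
    by (rule tail_mu_shift) blast
  define E where "E = exp (\<kappa> * (c + d + 1))"
  have "tail \<mu> x \<le> (E * 4 * (A + 1) / q) * tail (M s) x" for x
  proof -
    \<comment> \<open>Shifting by \<open>c + d\<close> at the start makes the two later shifts
      cancel.\<close>
    have "tail \<mu> x \<le> E * tail \<mu> (x + c + d)"
      using \<kappa>(2)[of "c + d" "x + c + d"] c d by (simp add: E_def)
    also have "\<dots> \<le> E * (4 * A * tail (CP s) (x + c + d - c))"
      by (intro mult_left_mono le3) (simp add: E_def)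
    also have "\<dots> \<le> E * (4 * A * (tail (M s) (x + c + d - c - d) / q))"
      using A by (intro mult_left_mono le4) (auto simp: E_def)
    also have "\<dots> = E * (4 * A * (tail (M s) x / q))" by simp
    also have "\<dots> \<le> E * (4 * (A + 1) * (tail (M s) x / q))"
      using A d tail_bounds[OF rd_M[OF s]]
      by (intro mult_left_mono mult_right_mono) (auto simp: E_def q_def)
    also have "\<dots> = (E * 4 * (A + 1) / q) * tail (M s) x" by simp
    finally show ?thesis .
  qed
  moreover have "E * 4 * (A + 1) / q > 0" using A d by (simp add: E_def q_def)
  ultimately show ?thesis using that by blast
qed

lemma asymp_incr_M:
  assumes t0: "t0 > 0" "asymp_incr (M t0)" and t: "t > 0"
  shows "asymp_incr (M t)"
proof -
  have small: "asymp_incr (M s)" if "0 < s" "s < t0" for s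
  proof (rule asymp_incr_factor)
    show "asymp_incr (M s \<star> M (t0 - s))" using M_add[of s "t0 - s"] that t0 by simp
  qed (use that in \<open>auto intro: dominated_M asymp_decr_M\<close>)
  have mult: "asymp_incr (M (real (Suc n) * s))" if "0 < s" "s < t0" for n s
  proof (induction n)
    case 0
    then show ?case using small that by simp
  next
    case (Suc n)
    have pos: "0 < real (Suc n) * s" using that by simp
    have "M (real (Suc (Suc n)) * s) = (M (real (Suc n) * s) \<star> M s)"
      using M_add[OF pos, of s] that by (simp add: algebra_simps)
    then show ?case
      using asymp_incr_convolution[OF dominated_M[OF pos] dominated_M Suc small[OF that]] that by simp
  qed
  obtain n where "t / t0 < real n" using reals_Archimedean2 by blast
  then have "t < real (Suc n) * t0" using t0 by (simp add: field_simps)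
  then have "t / real (Suc n) < t0" by (simp add: divide_less_eq mult.commute)
  then show ?thesis using mult[of "t / real (Suc n)" n] t by simp
qed

lemma class_L_imp_asymp_incr:
  assumes t: "t > 0" and L: "M t \<in> class_L \<gamma>"
  shows "asymp_incr (M t)"
  unfolding asymp_incr_def
proof (intro allI impI)
  fix a \<epsilon> :: real assume a: "0 \<le> a" and eps: "0 < \<epsilon>"
  obtain C where C: "C > 0" "\<And>x. tail (M t) x \<le> C * tail \<mu> x"
    by (rule dominatedE[OF dominated_M[OF t]]) blast
  have "((\<lambda>x. tail (M t) (x + - a) / (exp (- \<gamma> * - a) * tail (M t) x)) \<longlongrightarrow> 1) at_top"
    using L unfolding class_L_def by blast
  then have "\<forall>\<^sub>F x in at_top. tail (M t) (x + - a) / (exp (- \<gamma> * - a) * tail (M t) x) < 1 + \<epsilon> / C"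
    by (rule order_tendstoD(2)) (use C eps in simp)
  then show "\<forall>\<^sub>F x in at_top. drift (M t) a x \<le> \<epsilon> * tail \<mu> x"
    using eventually_gt_at_top[of 0]
  proof eventually_elim
    case (elim x)
    have pos: "tail (M t) x > 0" using L elim by (auto simp: class_L_def)
    have "tail (M t) (x - a) \<le> (1 + \<epsilon> / C) * (exp (\<gamma> * a) * tail (M t) x)"
      using elim pos by (simp add: divide_less_eq)
    then have "exp (- \<gamma> * a) * tail (M t) (x - a) \<le>
        exp (- \<gamma> * a) * ((1 + \<epsilon> / C) * (exp (\<gamma> * a) * tail (M t) x))"
      by (intro mult_left_mono) auto
    also have "\<dots> = (1 + \<epsilon> / C) * tail (M t) x"
      by (simp add: exp_minus field_simps)
    finally have "drift (M t) a x \<le> \<epsilon> / C * tail (M t) x" by (simp add: drift_def algebra_simps)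
    also have "\<dots> \<le> \<epsilon> / C * (C * tail \<mu> x)" using C eps by (intro mult_left_mono) auto
    finally show ?case using C by simp
  qed
qed

text \<open>\<open>asymp_decr_M\<close> supplies the other bound on the drift. Both errors are
  relative to \<open>tail \<mu>\<close>; \<open>tail_mu_le_tail_M\<close> makes them relative to the
  tail of \<open>M t\<close> and also gives its positivity.\<close>

lemma asymp_incr_imp_class_L:
  assumes t: "t > 0" and incr: "asymp_incr (M t)"
  shows "M t \<in> class_L \<gamma>"
proof -
  obtain C where C: "C > 0" "\<And>x. tail \<mu> x \<le> C * tail (M t) x"
    by (rule tail_mu_le_tail_M[OF t]) blast
  have pos: "tail (M t) x > 0" for x
    using C(1) C(2)[of x] tail_mu_pos[of x] by (smt (verit) zero_less_mult_pos)
  have lim: "((\<lambda>x. exp (- \<gamma> * a) * tail (M t) (x - a) / tail (M t) x) \<longlongrightarrow> 1) at_top" if a: "a \<ge> 0" for a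
  proof (rule tendstoI)
    fix e :: real assume e: "e > 0"
    define \<delta> where "\<delta> = e / (2 * C)"
    have \<delta>: "\<delta> > 0" "\<delta> * C < e" using e C by (auto simp: \<delta>_def)
    have "\<forall>\<^sub>F x in at_top. drift (M t) a x \<le> \<delta> * tail \<mu> x"
      using incr a \<delta> unfolding asymp_incr_def by blast
    moreover have "\<forall>\<^sub>F x in at_top. - \<delta> * tail \<mu> x \<le> drift (M t) a x"
      using asymp_decr_M[OF t] a \<delta> unfolding asymp_decr_def by blast
    ultimately show "\<forall>\<^sub>F x in at_top. dist (exp (- \<gamma> * a) * tail (M t) (x - a) / tail (M t) x) 1 < e"
    proof eventually_elim
      case (elim x)
      have "exp (- \<gamma> * a) * tail (M t) (x - a) / tail (M t) x - 1 = drift (M t) a x / tail (M t) x"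
        using pos[of x] by (simp add: drift_def field_simps)
      then have "dist (exp (- \<gamma> * a) * tail (M t) (x - a) / tail (M t) x) 1 = \<bar>drift (M t) a x\<bar> / tail (M t) x"
        using pos[of x] by (simp add: dist_real_def)
      also have "\<dots> \<le> \<delta> * (C * tail (M t) x) / tail (M t) x"
      proof (intro divide_right_mono)
        have "\<bar>drift (M t) a x\<bar> \<le> \<delta> * tail \<mu> x" using elim by auto
        also have "\<dots> \<le> \<delta> * (C * tail (M t) x)" using C \<delta> by (intro mult_left_mono) auto
        finally show "\<bar>drift (M t) a x\<bar> \<le> \<delta> * (C * tail (M t) x)" .
      qed (use pos[of x] in simp)
      also have "\<dots> < e" using \<delta> pos[of x] by simp
      finally show ?case .
    qed
  qed
  have "((\<lambda>x. tail (M t) (x + a) / (exp (- \<gamma> * a) * tail (M t) x)) \<longlongrightarrow> 1) at_top" for a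
  proof (cases "a \<le> 0")
    case True
    have "exp (- \<gamma> * - a) * tail (M t) (x - - a) / tail (M t) x = tail (M t) (x + a) / (exp (- \<gamma> * a) * tail (M t) x)" for x
      by (simp add: exp_minus field_simps)
    then show ?thesis using lim[of "- a"] True by simp
  next
    case False
    have f: "filterlim (\<lambda>x. x + a) at_top at_top"
      using filterlim_tendsto_add_at_top[OF tendsto_const[of a] filterlim_ident] by (simp add: add.commute)
    \<comment> \<open>A positive shift is the negative one seen from \<open>x + a\<close>,
      inverted.\<close>
    have "((\<lambda>x. exp (- \<gamma> * a) * tail (M t) (x + a - a) / tail (M t) (x + a)) \<longlongrightarrow> 1) at_top"
      using False by (intro filterlim_compose[OF lim[of a] f]) simp
    then have "((\<lambda>x. inverse (exp (- \<gamma> * a) * tail (M t) x / tail (M t) (x + a))) \<longlongrightarrow> inverse 1) at_top"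
      by (intro tendsto_inverse) auto
    then show ?thesis by (simp add: inverse_eq_divide)
  qed
  then show ?thesis unfolding class_L_def using rd_M[OF t] pos by blast
qed

theorem class_L_dichotomy:
  assumes "t0 > 0" "M t0 \<in> class_L \<gamma>" "t > 0"
  shows "M t \<in> class_L \<gamma>"
  using assms class_L_imp_asymp_incr asymp_incr_M asymp_incr_imp_class_L by blast

end

subsection \<open>Compound Poisson distributions\<close>

definition compound_poisson :: "real \<Rightarrow> real measure \<Rightarrow> real measure" where
  "compound_poisson r \<rho> = measure_pmf (poisson_pmf r) \<bind> conv_power \<rho>"

context
  fixes r :: real and \<rho> :: "real measure"
  assumes r: "r > 0" and \<rho>: "real_distribution \<rho>"
begin

lemma conv_power_kernel: "conv_power \<rho> \<in> measurable (measure_pmf (poisson_pmf r)) (subprob_algebra borel)"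
proof -
  interpret P: real_distribution "conv_power \<rho> n" for n by (rule real_distribution_conv_power[OF \<rho>])
  show ?thesis
    unfolding measurable_pmf_measure1 space_subprob_algebra
    using P.subprob_space_axioms P.events_eq_borel by blast
qed

lemma real_distribution_compound_poisson: "real_distribution (compound_poisson r \<rho>)"
proof -
  interpret P: real_distribution "conv_power \<rho> n" for n by (rule real_distribution_conv_power[OF \<rho>])
  have "prob_space (compound_poisson r \<rho>)"
    unfolding compound_poisson_def
    by (rule prob_space.prob_space_bind[OF measure_pmf.prob_space_axioms _ conv_power_kernel])
       (simp add: P.prob_space_axioms)
  moreover have "sets (compound_poisson r \<rho>) = sets borel"
    unfolding compound_poisson_def by (rule sets_bind[OF P.events_eq_borel]) simp
  ultimately show ?thesis by (simp add: real_distribution_def real_distribution_axioms_def)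
qed

text \<open>Integration through the Poisson mixture for bounded test functions: indicators give the
  tails, \<open>cos\<close> and \<open>sin\<close> the characteristic function.\<close>

lemma integral_compound_poisson_sums:
  fixes f :: "real \<Rightarrow> real"
  assumes f: "f \<in> borel_measurable borel" and B: "\<And>x. \<bar>f x\<bar> \<le> B"
  shows "(\<lambda>n. exp (- r) * r ^ n / fact n * (LINT x|conv_power \<rho> n. f x)) sums
    (LINT x|compound_poisson r \<rho>. f x)"
proof -
  interpret P: real_distribution "conv_power \<rho> n" for n by (rule real_distribution_conv_power[OF \<rho>])
  have eq: "(LINT x|compound_poisson r \<rho>. f x) =
      (LINT n|measure_pmf (poisson_pmf r). LINT x|conv_power \<rho> n. f x)"
    unfolding compound_poisson_def
    using P.emeasure_space_1
    by (intro integral_bind[where K=borel and B=B and B'=1, OF f B conv_power_kernel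
          measure_pmf.finite_measure_axioms]) (simp del: P.space_eq_univ)
  have "\<bar>LINT x|conv_power \<rho> n. f x\<bar> \<le> B" for n
  proof -
    have "\<bar>LINT x|conv_power \<rho> n. f x\<bar> \<le> (LINT x|conv_power \<rho> n. \<bar>f x\<bar>)"
      by (rule integral_abs_bound)
    also have "\<dots> \<le> (LINT x|conv_power \<rho> n. B)"
      using f B
      by (intro integral_mono borel_measurable_abs borel_measurable_const
            integrable_bounded_real_distribution[OF real_distribution_conv_power[OF \<rho>], where B="\<bar>B\<bar>"])
         (auto intro: order_trans[OF _ abs_ge_self])
    also have "\<dots> = B" using P.prob_space by simp
    finally show ?thesis .
  qed
  then have "integrable (measure_pmf (poisson_pmf r)) (\<lambda>n. LINT x|conv_power \<rho> n. f x)"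
    by (intro measure_pmf.integrable_const_bound[where B=B]) auto
  then have "integrable (count_space UNIV) (\<lambda>n. pmf (poisson_pmf r) n *\<^sub>R (LINT x|conv_power \<rho> n. f x))"
    by (subst (asm) measure_pmf_eq_density, subst (asm) integrable_density) auto
  from sums_integral_count_space_nat[OF this]
  have "(\<lambda>n. pmf (poisson_pmf r) n *\<^sub>R (LINT x|conv_power \<rho> n. f x)) sums (LINT x|compound_poisson r \<rho>. f x)"
    unfolding eq by (subst measure_pmf_eq_density, subst integral_density) auto
  then show ?thesis using r by (simp add: mult_ac)
qed

lemma tail_compound_poisson_sums:
  "(\<lambda>n. exp (- r) * r ^ n / fact n * tail (conv_power \<rho> n) x) sums tail (compound_poisson r \<rho>) x"
  unfolding tail_eq_integral[OF real_distribution_compound_poisson]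
    tail_eq_integral[OF real_distribution_conv_power[OF \<rho>]]
  by (rule integral_compound_poisson_sums[where B=1]) (auto split: split_indicator)

lemma char_compound_poisson: "char (compound_poisson r \<rho>) z = exp (of_real r * (char \<rho> z - 1))"
proof -
  have Re: "Re (char P z) = (LINT x|P. cos (z * x))" and Im: "Im (char P z) = (LINT x|P. sin (z * x))"
    if "real_distribution P" for P
  proof -
    interpret real_distribution P by fact
    have "integrable P (\<lambda>x. iexp (z * x))" by (rule integrable_iexp) auto
    from integral_Re[OF this] integral_Im[OF this]
    show "Re (char P z) = (LINT x|P. cos (z * x))" "Im (char P z) = (LINT x|P. sin (z * x))"
      unfolding char_def by (simp_all add: Re_exp Im_exp)
  qed
  note rd = real_distribution_conv_power[OF \<rho>] real_distribution_compound_poisson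
  have "(\<lambda>n. complex_of_real (exp (- r) * r ^ n / fact n) * char (conv_power \<rho> n) z) sums char (compound_poisson r \<rho>) z"
    unfolding sums_complex_iff
    using integral_compound_poisson_sums[of "\<lambda>x. cos (z * x)" 1]
      integral_compound_poisson_sums[of "\<lambda>x. sin (z * x)" 1]
    by (simp add: Re[OF rd(1)] Re[OF rd(2)] Im[OF rd(1)] Im[OF rd(2)] del: of_real_mult of_real_divide)
  moreover have "(\<lambda>n. complex_of_real (exp (- r)) * ((of_real r * char \<rho> z) ^ n /\<^sub>R fact n)) sums
      (of_real (exp (- r)) * exp (of_real r * char \<rho> z))"
    by (intro sums_mult exp_converges)
  moreover have "complex_of_real (exp (- r)) * ((of_real r * char \<rho> z) ^ n /\<^sub>R fact n) =
      complex_of_real (exp (- r) * r ^ n / fact n) * char (conv_power \<rho> n) z" for n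
    by (simp add: char_conv_power[OF \<rho>] power_mult_distrib scaleR_conv_of_real field_simps)
  ultimately have "char (compound_poisson r \<rho>) z = of_real (exp (- r)) * exp (of_real r * char \<rho> z)"
    by (auto dest: sums_unique2)
  also have "\<dots> = exp (of_real r * (char \<rho> z - 1))"
    unfolding exp_of_real[symmetric] exp_add[symmetric] by (simp add: algebra_simps)
  finally show ?thesis .
qed

lemma nn_integral_exp_compound_poisson:
  assumes m: "(\<integral>\<^sup>+x. ennreal (exp (c * x)) \<partial>\<rho>) = ennreal m" "m \<ge> 0"
  shows "(\<integral>\<^sup>+x. ennreal (exp (c * x)) \<partial>compound_poisson r \<rho>) = ennreal (exp (r * (m - 1)))"
proof -
  have "(\<integral>\<^sup>+x. ennreal (exp (c * x)) \<partial>compound_poisson r \<rho>) =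
      (\<integral>\<^sup>+n. \<integral>\<^sup>+x. ennreal (exp (c * x)) \<partial>conv_power \<rho> n \<partial>measure_pmf (poisson_pmf r))"
    unfolding compound_poisson_def by (rule nn_integral_bind[OF _ conv_power_kernel]) simp
  also have "\<dots> = (\<Sum>n. ennreal (pmf (poisson_pmf r) n) * ennreal (m ^ n))"
    by (simp add: nn_integral_exp_conv_power[OF \<rho>] m nn_integral_measure_pmf nn_integral_count_space_nat
        ennreal_power)
  also have "\<dots> = (\<Sum>n. ennreal (exp (- r) * ((r * m) ^ n /\<^sub>R fact n)))"
    using r m by (intro suminf_cong) (simp add: power_mult_distrib field_simps flip: ennreal_mult)
  also have "\<dots> = ennreal (exp (- r) * exp (r * m))"
    using r m by (intro suminf_ennreal_eq sums_mult exp_converges) auto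
  also have "exp (- r) * exp (r * m) = exp (r * (m - 1))"
    by (simp add: algebra_simps flip: exp_add)
  finally show ?thesis .
qed

end

section \<open>Compound Poisson laws of restricted jump measures\<close>

lemma integral_uniform_measure:
  fixes f :: "'a \<Rightarrow> 'b::{banach, second_countable_topology}"
  assumes [measurable]: "S \<in> sets M" "f \<in> borel_measurable M" and S: "measure M S > 0"
  shows "(LINT x|uniform_measure M S. f x) = (LINT x:S|M. f x) /\<^sub>R measure M S"
proof -
  \<comment> \<open>\<open>measure\<close> is 0 on sets of infinite measure, so positivity makes
    \<open>S\<close> a set of finite measure.\<close>
  have em: "emeasure M S = ennreal (measure M S)"
    using S by (intro emeasure_eq_ennreal_measure) (auto simp: measure_def)
  have "uniform_measure M S = density M (\<lambda>x. ennreal (indicator S x / measure M S))"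
    unfolding uniform_measure_def em using S
    by (intro density_cong) (auto split: split_indicator simp: divide_ennreal simp flip: ennreal_1)
  then have "(LINT x|uniform_measure M S. f x) = (LINT x|M. (indicator S x / measure M S) *\<^sub>R f x)"
    using S by (simp add: integral_density)
  also have "\<dots> = (LINT x|M. (indicator S x *\<^sub>R f x) /\<^sub>R measure M S)"
    by (intro Bochner_Integration.integral_cong refl) (simp add: divide_inverse mult.commute)
  also have "\<dots> = (LINT x:S|M. f x) /\<^sub>R measure M S"
    unfolding set_lebesgue_integral_def by (rule integral_scaleR_right)
  finally show ?thesis .
qed

text \<open>The law at time \<open>t\<close> of the process whose jumps are those of \<open>\<nu>\<close> in \<open>S\<close>.\<close>

definition jump_law :: "real measure \<Rightarrow> real set \<Rightarrow> real \<Rightarrow> real measure" where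
  "jump_law \<nu> S t = (if measure \<nu> S = 0 then return borel 0
     else compound_poisson (t * measure \<nu> S) (uniform_measure \<nu> S))"

context
  fixes \<nu> :: "real measure" and S :: "real set"
  assumes sets_nu: "sets \<nu> = sets borel" and S: "S \<in> sets borel" and fin: "emeasure \<nu> S < \<infinity>"
begin

lemma real_distribution_uniform:
  assumes "measure \<nu> S \<noteq> 0"
  shows "real_distribution (uniform_measure \<nu> S)"
proof -
  have "emeasure \<nu> S \<noteq> 0" using assms by (auto simp: measure_def)
  then have "prob_space (uniform_measure \<nu> S)" using fin by (intro prob_space_uniform_measure) auto
  then show ?thesis by (simp add: real_distribution_def real_distribution_axioms_def sets_nu)
qed

lemma real_distribution_jump_law:
  "t > 0 \<Longrightarrow> real_distribution (jump_law \<nu> S t)"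
  using real_distribution_return_borel real_distribution_compound_poisson real_distribution_uniform
  by (auto simp: jump_law_def zero_less_measure_iff)

lemma set_integrable_bounded:
  fixes f :: "real \<Rightarrow> 'b::{banach, second_countable_topology}"
  assumes "f \<in> borel_measurable borel" "\<And>x. x \<in> S \<Longrightarrow> norm (f x) \<le> B"
  shows "set_integrable \<nu> S f"
proof -
  have m: "f \<in> borel_measurable \<nu>" "S \<in> sets \<nu>"
    using assms S sets_nu by (auto cong: measurable_cong_sets)
  have "integrable \<nu> (\<lambda>x. \<bar>B\<bar> * indicator S x)"
    using fin m by (intro integrable_mult_right integrable_real_indicator) auto
  then show ?thesis unfolding set_integrable_def
    by (rule Bochner_Integration.integrable_bound)
       (use m assms(2) in \<open>auto intro!: AE_I2 split: split_indicator intro: order_trans[OF _ abs_ge_self]\<close>)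
qed

lemma set_integral_one: "(LINT x:S|\<nu>. (1::'b::{banach, second_countable_topology, real_normed_algebra_1})) = of_real (measure \<nu> S)"
  using S fin sets_nu by (subst set_integral_const) (auto simp: of_real_def)

lemma char_jump_law:
  assumes t: "t > 0"
  shows "char (jump_law \<nu> S t) z = exp (of_real t * (LINT x:S|\<nu>. iexp (z * x) - 1))"
proof (cases "measure \<nu> S = 0")
  case True
  then have "emeasure \<nu> S = 0" using fin by (auto simp: measure_def enn2real_eq_0_iff)
  then have "AE x in \<nu>. x \<notin> S" using S sets_nu by (intro AE_not_in) (auto simp: null_sets_def)
  then have "(LINT x:S|\<nu>. iexp (z * x) - 1) = 0"
    unfolding set_lebesgue_integral_def by (intro integral_eq_zero_AE) auto
  then show ?thesis using True by (simp add: jump_law_def char_return_borel)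
next
  case False
  then have pos: "measure \<nu> S > 0" by (simp add: zero_less_measure_iff)
  have "char (uniform_measure \<nu> S) z = (LINT x:S|\<nu>. iexp (z * x)) /\<^sub>R measure \<nu> S"
    unfolding char_def using sets_nu S
    by (intro integral_uniform_measure pos) (auto cong: measurable_cong_sets)
  then have "of_real (t * measure \<nu> S) * (char (uniform_measure \<nu> S) z - 1) =
      of_real t * ((LINT x:S|\<nu>. iexp (z * x)) - of_real (measure \<nu> S))"
    using pos by (simp add: scaleR_conv_of_real field_simps)
  also have "\<dots> = of_real t * (LINT x:S|\<nu>. iexp (z * x) - 1)"
    by (subst set_integral_diff(2)) (auto intro!: set_integrable_bounded[where B=1] simp: set_integral_one)
  finally have eq: "of_real (t * measure \<nu> S) * (char (uniform_measure \<nu> S) z - 1) =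
      of_real t * (LINT x:S|\<nu>. iexp (z * x) - 1)" .
  have "char (jump_law \<nu> S t) z = exp (of_real (t * measure \<nu> S) * (char (uniform_measure \<nu> S) z - 1))"
    using False t pos unfolding jump_law_def
    by (simp only: if_False) (intro char_compound_poisson real_distribution_uniform; simp)
  then show ?thesis unfolding eq .
qed

lemma nn_integral_exp_jump_law:
  assumes t: "t > 0" and B: "\<And>x. x \<in> S \<Longrightarrow> exp (c * x) \<le> B"
  shows "(\<integral>\<^sup>+x. ennreal (exp (c * x)) \<partial>jump_law \<nu> S t) = ennreal (exp (t * (LINT x:S|\<nu>. exp (c * x) - 1)))"
proof (cases "measure \<nu> S = 0")
  case True
  then have "emeasure \<nu> S = 0" using fin by (auto simp: measure_def enn2real_eq_0_iff)
  then have "AE x in \<nu>. x \<notin> S" using S sets_nu by (intro AE_not_in) (auto simp: null_sets_def)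
  then have "(LINT x:S|\<nu>. exp (c * x) - 1) = 0"
    unfolding set_lebesgue_integral_def by (intro integral_eq_zero_AE) auto
  then show ?thesis using True by (simp add: jump_law_def nn_integral_return)
next
  case False
  then have pos: "measure \<nu> S > 0" by (simp add: zero_less_measure_iff)
  have int: "set_integrable \<nu> S (\<lambda>x. exp (c * x))"
    using B by (intro set_integrable_bounded[where B=B]) auto
  define m where "m = (LINT x:S|\<nu>. exp (c * x)) / measure \<nu> S"
  have nn: "(LINT x:S|\<nu>. exp (c * x)) \<ge> 0"
    unfolding set_lebesgue_integral_def by (intro Bochner_Integration.integral_nonneg) auto
  have "(\<integral>\<^sup>+x. ennreal (exp (c * x)) \<partial>uniform_measure \<nu> S) =
      (\<integral>\<^sup>+x. ennreal (exp (c * x)) * indicator S x \<partial>\<nu>) / emeasure \<nu> S"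
    using sets_nu S by (intro nn_integral_uniform_measure) (auto cong: measurable_cong_sets)
  also have "(\<integral>\<^sup>+x. ennreal (exp (c * x)) * indicator S x \<partial>\<nu>) = (\<integral>\<^sup>+x. ennreal (indicator S x *\<^sub>R exp (c * x)) \<partial>\<nu>)"
    by (intro nn_integral_cong) (auto split: split_indicator)
  also have "\<dots> = ennreal (LINT x:S|\<nu>. exp (c * x))"
    using int unfolding set_integrable_def set_lebesgue_integral_def
    by (intro nn_integral_eq_integral) auto
  also have "emeasure \<nu> S = ennreal (measure \<nu> S)"
    using fin by (intro emeasure_eq_ennreal_measure) auto
  also have "ennreal (LINT x:S|\<nu>. exp (c * x)) / ennreal (measure \<nu> S) = ennreal m"
    using nn pos by (simp add: m_def divide_ennreal)
  finally have *: "(\<integral>\<^sup>+x. ennreal (exp (c * x)) \<partial>uniform_measure \<nu> S) = ennreal m" .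
  have "t * measure \<nu> S * (m - 1) = t * ((LINT x:S|\<nu>. exp (c * x)) - measure \<nu> S)"
    using pos by (simp add: m_def field_simps)
  also have "(LINT x:S|\<nu>. exp (c * x)) - measure \<nu> S = (LINT x:S|\<nu>. exp (c * x) - 1)"
    using int set_integral_one[where 'b=real]
    by (subst set_integral_diff(2)) (auto intro!: set_integrable_bounded[where B=1])
  finally have **: "t * measure \<nu> S * (m - 1) = t * (LINT x:S|\<nu>. exp (c * x) - 1)" .
  have "m \<ge> 0" using nn pos by (simp add: m_def)
  then show ?thesis
    using nn_integral_exp_compound_poisson[OF _ real_distribution_uniform[OF False] *, of "t * measure \<nu> S"] t pos False
    unfolding ** by (simp add: jump_law_def)
qed

end

subsection \<open>Normal distributions\<close>

text \<open>\<open>s\<close> is the standard deviation. As an image of the standard normal law this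
  includes the point mass \<open>s = 0\<close>, so a vanishing Gaussian part needs no separate
  case.\<close>

definition normal_law :: "real \<Rightarrow> real \<Rightarrow> real measure" where
  "normal_law b s = distr std_normal_distribution borel (\<lambda>x. b + s * x)"

lemma real_distribution_normal_law: "real_distribution (normal_law b s)"
proof -
  interpret real_distribution std_normal_distribution by (rule real_dist_normal_dist)
  show ?thesis unfolding normal_law_def by (rule real_distribution_distr) simp
qed

lemma char_normal_law: "char (normal_law b s) z = exp (\<i> * of_real (z * b) - of_real ((s * z)\<^sup>2 / 2))"
proof -
  have "char (normal_law b s) z = (LINT x|std_normal_distribution. iexp (z * b) * iexp ((s * z) * x))"
    unfolding char_def normal_law_def
    by (subst integral_distr) (auto intro!: Bochner_Integration.integral_cong simp: algebra_simps simp flip: exp_add)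
  also have "\<dots> = iexp (z * b) * char std_normal_distribution (s * z)"
    by (simp add: char_def)
  also have "\<dots> = iexp (z * b) * exp (- of_real ((s * z)\<^sup>2 / 2))"
    by (simp add: char_std_normal_distribution flip: exp_of_real)
  also have "\<dots> = exp (\<i> * of_real (z * b) - of_real ((s * z)\<^sup>2 / 2))"
    by (simp only: exp_add[symmetric] add_uminus_conv_diff)
  finally show ?thesis .
qed

lemma nn_integral_exp_normal_law:
  "(\<integral>\<^sup>+x. ennreal (exp (c * x)) \<partial>normal_law b s) = ennreal (exp (c * b + (c * s)\<^sup>2 / 2))"
proof -
  have "(\<integral>\<^sup>+x. ennreal (exp (c * x)) \<partial>normal_law b s) =
      (\<integral>\<^sup>+x. ennreal (std_normal_density x) * ennreal (exp (c * (b + s * x))) \<partial>lborel)"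
    unfolding normal_law_def by (subst nn_integral_distr) (auto simp: nn_integral_density)
  also have "\<dots> = (\<integral>\<^sup>+x. ennreal (exp (c * b + (c * s)\<^sup>2 / 2)) * ennreal (normal_density (c * s) 1 x) \<partial>lborel)"
  proof (intro nn_integral_cong)
    \<comment> \<open>Completing the square: the exponential tilt moves the mean to
      \<open>c * s\<close>.\<close>
    fix x
    have "- x\<^sup>2 / 2 + c * (b + s * x) = (c * b + (c * s)\<^sup>2 / 2) + (- (x - c * s)\<^sup>2 / 2)"
      by (simp add: power2_eq_square field_simps)
    then have "std_normal_density x * exp (c * (b + s * x)) =
        exp (c * b + (c * s)\<^sup>2 / 2) * normal_density (c * s) 1 x"
      unfolding std_normal_density_def normal_density_def by (simp add: mult_ac flip: exp_add)
    then show "ennreal (std_normal_density x) * ennreal (exp (c * (b + s * x))) =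
        ennreal (exp (c * b + (c * s)\<^sup>2 / 2)) * ennreal (normal_density (c * s) 1 x)"
      by (simp flip: ennreal_mult)
  qed
  also have "\<dots> = ennreal (exp (c * b + (c * s)\<^sup>2 / 2)) * (\<integral>\<^sup>+x. ennreal (normal_density (c * s) 1 x) \<partial>lborel)"
    by (rule nn_integral_cmult) simp
  also have "(\<integral>\<^sup>+x. ennreal (normal_density (c * s) 1 x) \<partial>lborel) = 1"
    using prob_space.emeasure_space_1[OF prob_space_normal_density[of 1 "c * s"]]
    by (simp add: emeasure_density)
  finally show ?thesis by simp
qed

subsection \<open>The factor with light right tail\<close>

lemma integrable_exp_iff:
  assumes "real_distribution P"
  shows "integrable P (\<lambda>x. exp (c * x)) \<longleftrightarrow> (\<integral>\<^sup>+x. ennreal (exp (c * x)) \<partial>P) < \<infinity>"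
proof -
  interpret real_distribution P by fact
  show ?thesis by (simp add: integrable_iff_bounded)
qed

lemma light_tailed_convolution:
  assumes "light_tailed \<rho>" "light_tailed \<sigma>"
  shows "light_tailed (\<rho> \<star> \<sigma>)"
  using assms unfolding light_tailed_def
  by (auto simp: integrable_exp_iff real_distribution_convolution nn_integral_exp_convolution
      ennreal_mult_less_top)

text \<open>Markov's inequality for \<open>exp (c * x)\<close>; \<open>c\<close> may be negative,
  which covers left tails.\<close>

lemma measure_le_exp_moment:
  assumes P: "real_distribution P" and K: "(\<integral>\<^sup>+x. ennreal (exp (c * x)) \<partial>P) \<le> ennreal K" "K \<ge> 0"
    and A: "A \<in> sets borel" "\<And>x. x \<in> A \<Longrightarrow> c * x \<ge> u"
  shows "measure P A \<le> exp (- u) * K"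
proof -
  interpret real_distribution P by fact
  have int: "integrable P (\<lambda>x. exp (c * x))"
    using K by (simp add: integrable_exp_iff[OF P] order_le_less_trans)
  have "exp u * measure P A = (LINT x|P. exp u * indicator A x)"
    using A by simp
  also have "\<dots> \<le> (LINT x|P. exp (c * x))"
    using A by (intro integral_mono int integrable_bounded_real_distribution[OF P, where B="exp u"])
      (auto split: split_indicator)
  also have "\<dots> \<le> K"
  proof -
    have "ennreal (LINT x|P. exp (c * x)) \<le> ennreal K"
      using K by (subst nn_integral_eq_integral[OF int, symmetric]) auto
    then show ?thesis using K by simp
  qed
  finally show ?thesis by (simp add: exp_minus field_simps)
qed

text \<open>Uniform moments at \<open>c = 1\<close> and \<open>c = -1\<close> give tightness, hence
  a weak limit along a subsequence; the characteristic functions converge along the whole sequence,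
  so that limit has characteristic function \<open>\<phi>\<close>.\<close>

lemma exp_moment_limit:
  assumes rd: "\<And>n::nat. real_distribution (P n)"
    and mom: "\<And>c. \<exists>K. \<forall>n. (\<integral>\<^sup>+x. ennreal (exp (c * x)) \<partial>P n) \<le> ennreal K"
    and lim: "\<And>z. (\<lambda>n. char (P n) z) \<longlonglongrightarrow> \<phi> z"
  shows "\<exists>Q. light_tailed Q \<and> (\<forall>z. char Q z = \<phi> z)"
proof -
  interpret P: real_distribution "P n" for n by (rule rd)
  have mom': "\<exists>K\<ge>0. \<forall>n. (\<integral>\<^sup>+x. ennreal (exp (c * x)) \<partial>P n) \<le> ennreal K" for c
  proof -
    obtain K where "\<forall>n. (\<integral>\<^sup>+x. ennreal (exp (c * x)) \<partial>P n) \<le> ennreal K" using mom by blast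
    then have "\<forall>n. (\<integral>\<^sup>+x. ennreal (exp (c * x)) \<partial>P n) \<le> ennreal (max 0 K)"
      by (auto intro: order_trans ennreal_leI)
    then show ?thesis by (intro exI[of _ "max 0 K"]) auto
  qed
  have "tight P"
    unfolding tight_def
  proof (intro conjI allI impI rd)
    fix \<epsilon> :: real assume eps: "\<epsilon> > 0"
    obtain K1 where K1: "K1 \<ge> 0" "\<And>n. (\<integral>\<^sup>+x. ennreal (exp (1 * x)) \<partial>P n) \<le> ennreal K1"
      using mom'[of 1] by blast
    obtain K2 where K2: "K2 \<ge> 0" "\<And>n. (\<integral>\<^sup>+x. ennreal (exp ((-1) * x)) \<partial>P n) \<le> ennreal K2"
      using mom'[of "-1"] by blast
    have "((\<lambda>u::real. (K1 + K2) * exp (- u)) \<longlongrightarrow> (K1 + K2) * 0) at_top"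
      by (intro tendsto_intros filterlim_compose[OF exp_at_bot filterlim_uminus_at_bot_at_top])
    then have "\<forall>\<^sub>F u in at_top. (K1 + K2) * exp (- u) < \<epsilon>"
      by (rule order_tendstoD(2)) (use eps in simp)
    then have "\<forall>\<^sub>F u in at_top. (K1 + K2) * exp (- u) < \<epsilon> \<and> u > 0"
      using eventually_gt_at_top[of 0] by (rule eventually_conj)
    then obtain u where u: "(K1 + K2) * exp (- u) < \<epsilon>" "u > 0"
      by (auto simp: eventually_at_top_linorder)
    have "1 - \<epsilon> < measure (P n) {-u<..u}" for n
    proof -
      have "measure (P n) {u<..} \<le> exp (- u) * K1"
        by (rule measure_le_exp_moment[OF rd K1(2) K1(1)]) auto
      moreover have "measure (P n) {..-u} \<le> exp (- u) * K2"
        by (rule measure_le_exp_moment[OF rd K2(2) K2(1)]) auto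
      moreover have "measure (P n) ({..-u} \<union> {u<..}) \<le> measure (P n) {..-u} + measure (P n) {u<..}"
        by (rule measure_Un_le) auto
      moreover have "measure (P n) {-u<..u} = 1 - measure (P n) ({..-u} \<union> {u<..})"
      proof -
        have "{-u<..u} = space (P n) - ({..-u} \<union> {u<..})" using u by auto
        then show ?thesis by (simp add: P.prob_compl del: P.space_eq_univ)
      qed
      ultimately show ?thesis using u by (simp add: algebra_simps)
    qed
    then show "\<exists>a b. a < b \<and> (\<forall>n. 1 - \<epsilon> < measure (P n) {a<..b})"
      using u by (intro exI[of _ "-u"] exI[of _ u]) auto
  qed
  from tight_imp_convergent_subsubsequence[OF this strict_mono_id]
  obtain s Q where s: "strict_mono s" and Q: "real_distribution Q" and w: "weak_conv_m (P \<circ> id \<circ> s) Q"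
    by blast
  then have w: "weak_conv_m (\<lambda>n. P (s n)) Q" by (simp add: comp_def)
  interpret Q: real_distribution Q by fact
  have "char Q z = \<phi> z" for z
  proof (rule LIMSEQ_unique)
    show "(\<lambda>n. char (P (s n)) z) \<longlonglongrightarrow> char Q z" by (rule levy_continuity1[OF rd Q w])
    show "(\<lambda>n. char (P (s n)) z) \<longlonglongrightarrow> \<phi> z"
      using LIMSEQ_subseq_LIMSEQ[OF lim s] by (simp add: comp_def)
  qed
  moreover have "integrable Q (\<lambda>x. exp (c * x))" for c
  proof -
    obtain K where K: "K \<ge> 0" "\<And>n. (\<integral>\<^sup>+x. ennreal (exp (c * x)) \<partial>P n) \<le> ennreal K"
      using mom' by blast
    \<comment> \<open>Weak convergence passes to bounded continuous functions; these truncations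
      increase to \<open>exp (c * x)\<close>, so monotone convergence carries the moment bound
      over.\<close>
    define f where "f L x = min (exp (c * x)) (real L)" for L :: nat and x
    have f: "f L \<in> borel_measurable borel" "\<bar>f L x\<bar> \<le> real L" "0 \<le> f L x" "isCont (f L) x" for L x
      unfolding f_def by (auto intro!: continuous_intros)
    have "(LINT x|Q. f L x) \<le> K" for L
    proof (rule LIMSEQ_le_const2)
      show "(\<lambda>n. LINT x|P (s n). f L x) \<longlonglongrightarrow> (LINT x|Q. f L x)"
        by (rule weak_conv_imp_integral_bdd_continuous_conv[OF rd Q w, where B="real L"]) (use f in auto)
      have "(LINT x|P n. f L x) \<le> K" for n
      proof -
        have "ennreal (LINT x|P n. f L x) = (\<integral>\<^sup>+x. ennreal (f L x) \<partial>P n)"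
          using f by (intro nn_integral_eq_integral[symmetric] integrable_bounded_real_distribution[OF rd, where B="real L"]) auto
        also have "\<dots> \<le> (\<integral>\<^sup>+x. ennreal (exp (c * x)) \<partial>P n)"
          by (intro nn_integral_mono ennreal_leI) (simp add: f_def)
        also have "\<dots> \<le> ennreal K" by (rule K)
        finally show ?thesis using K by simp
      qed
      then show "\<exists>N. \<forall>n\<ge>N. (LINT x|P (s n). f L x) \<le> K" by blast
    qed
    then have le: "(\<integral>\<^sup>+x. ennreal (f L x) \<partial>Q) \<le> ennreal K" for L
      using f by (subst nn_integral_eq_integral)
        (auto intro!: integrable_bounded_real_distribution[OF Q, where B="real L"] ennreal_leI)
    have "(\<integral>\<^sup>+x. ennreal (exp (c * x)) \<partial>Q) = (\<integral>\<^sup>+x. (SUP L. ennreal (f L x)) \<partial>Q)"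
    proof (intro nn_integral_cong antisym)
      fix x
      obtain L where "exp (c * x) \<le> real L" using real_arch_simple by blast
      then have "ennreal (exp (c * x)) = ennreal (f L x)" by (simp add: f_def min_def)
      then show "ennreal (exp (c * x)) \<le> (SUP L. ennreal (f L x))" by (metis SUP_upper UNIV_I)
      show "(SUP L. ennreal (f L x)) \<le> ennreal (exp (c * x))"
        by (intro SUP_least ennreal_leI) (simp add: f_def)
    qed
    also have "\<dots> = (SUP L. \<integral>\<^sup>+x. ennreal (f L x) \<partial>Q)"
      using f(1) by (intro nn_integral_monotone_convergence_SUP)
        (auto simp: incseq_def le_fun_def f_def intro!: ennreal_leI)
    also have "\<dots> \<le> ennreal K" by (intro SUP_least le)
    finally show ?thesis by (simp add: integrable_exp_iff[OF Q] order_le_less_trans)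
  qed
  ultimately show ?thesis using Q unfolding light_tailed_def by blast
qed

definition levy_integrand :: "real \<Rightarrow> real \<Rightarrow> complex" where
  "levy_integrand z x = iexp (z * x) - 1 - \<i> * complex_of_real (z * x * indicator {-1..1} x)"

lemma borel_measurable_levy_integrand [measurable]: "levy_integrand z \<in> borel_measurable borel"
  unfolding levy_integrand_def[abs_def] by measurable

text \<open>Second-order Taylor bound for |x| <= 1, triangle inequality beyond. The right side is
  the integrable majorant for the dominated convergence arguments.\<close>

lemma norm_levy_integrand_le: "cmod (levy_integrand z x) \<le> (2 + z\<^sup>2) * min 1 (x\<^sup>2)"
proof (cases "\<bar>x\<bar> \<le> 1")
  case True
  have "cmod (levy_integrand z x) \<le> (z * x)\<^sup>2 / 2"
    using iexp_approx1[of "z * x" 1] True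
    by (simp add: levy_integrand_def abs_le_iff diff_diff_eq numeral_2_eq_2 power2_eq_square)
  also have "\<dots> \<le> (2 + z\<^sup>2) * x\<^sup>2" by (simp add: power_mult_distrib algebra_simps)
  also have "x\<^sup>2 = min 1 (x\<^sup>2)" using True by (simp add: abs_square_le_1)
  finally show ?thesis .
next
  case False
  have "cmod (levy_integrand z x) \<le> cmod (iexp (z * x)) + cmod 1"
    using False norm_triangle_ineq4[of "iexp (z * x)" 1] by (auto simp: levy_integrand_def split: split_indicator)
  also have "\<dots> \<le> 2 + z\<^sup>2" by simp
  also have "\<dots> = (2 + z\<^sup>2) * min 1 (x\<^sup>2)"
    using False abs_square_less_1[of x] by (simp add: min_def not_less)
  finally show ?thesis .
qed

text \<open>Lagrange remainder of order two; it controls the exponential moments of compensated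
  small jumps.\<close>

lemma exp_remainder_le: "\<bar>exp u - 1 - u\<bar> \<le> u\<^sup>2 * exp \<bar>u\<bar>" for u :: real
proof -
  obtain v where v: "\<bar>v\<bar> \<le> \<bar>u\<bar>" "exp u = (\<Sum>m<2. u ^ m / fact m) + exp v / fact 2 * u ^ 2"
    using Maclaurin_exp_le[of u 2] by blast
  have "exp u - 1 - u = u\<^sup>2 * (exp v / 2)" using v(2) by (simp add: numeral_2_eq_2)
  also have "\<bar>\<dots>\<bar> \<le> u\<^sup>2 * exp \<bar>u\<bar>"
  proof -
    have "exp v \<le> exp \<bar>u\<bar>" using v(1) by auto
    then have "exp v / 2 \<le> exp \<bar>u\<bar>" using exp_gt_zero[of v] by linarith
    from mult_left_mono[OF this, of "u\<^sup>2"] show ?thesis by (simp add: abs_mult)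
  qed
  finally show ?thesis .
qed

locale levy_measure =
  fixes \<nu> :: "real measure"
  assumes sets_nu: "sets \<nu> = sets borel"
    and nu_int: "(\<integral>\<^sup>+ x. ennreal (min 1 (x\<^sup>2)) \<partial>\<nu>) < \<infinity>"
begin

lemma measurable_nu [simp, measurable_cong]: "sets \<nu> = sets borel"
  by (rule sets_nu)

lemma integrable_min: "integrable \<nu> (\<lambda>x. min 1 (x\<^sup>2))"
  using nu_int by (simp add: integrable_iff_bounded)

lemma integrable_levy_integrand: "integrable \<nu> (levy_integrand z)"
  by (rule Bochner_Integration.integrable_bound[OF integrable_mult_right[OF integrable_min, of "2 + z\<^sup>2"]])
     (auto intro!: AE_I2 order_trans[OF norm_levy_integrand_le])

lemma set_integrable_levy_integrand:
  "S \<in> sets borel \<Longrightarrow> set_integrable \<nu> S (levy_integrand z)"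
  unfolding set_integrable_def using integrable_levy_integrand
  by (intro integrable_mult_indicator) auto

lemma finite_away_from_zero:
  assumes S: "S \<in> sets borel" and \<delta>: "\<delta> > 0" "\<And>x. x \<in> S \<Longrightarrow> \<delta> \<le> \<bar>x\<bar>"
  shows "emeasure \<nu> S < \<infinity>"
proof -
  define k where "k = min 1 (\<delta>\<^sup>2)"
  have k: "k > 0" using \<delta> by (simp add: k_def)
  have "emeasure \<nu> S = (\<integral>\<^sup>+x. indicator S x \<partial>\<nu>)" using S by simp
  also have "\<dots> \<le> (\<integral>\<^sup>+x. ennreal (1 / k) * ennreal (min 1 (x\<^sup>2)) \<partial>\<nu>)"
  proof (intro nn_integral_mono)
    fix x
    have "1 \<le> 1 / k * min 1 (x\<^sup>2)" if "x \<in> S"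
    proof -
      have "\<delta>\<^sup>2 \<le> x\<^sup>2" using \<delta>(2)[OF that] \<delta>(1) by (simp add: abs_le_square_iff[symmetric])
      then have "k \<le> min 1 (x\<^sup>2)" by (auto simp: k_def)
      then show ?thesis using k by (simp add: field_simps)
    qed
    then show "indicator S x \<le> ennreal (1 / k) * ennreal (min 1 (x\<^sup>2))"
      using k by (auto split: split_indicator simp flip: ennreal_mult)
  qed
  also have "\<dots> = ennreal (1 / k) * (\<integral>\<^sup>+x. ennreal (min 1 (x\<^sup>2)) \<partial>\<nu>)"
    by (rule nn_integral_cmult) simp
  also have "\<dots> < \<infinity>" using nu_int by (simp add: ennreal_mult_less_top)
  finally show ?thesis .
qed

lemma finite_right: "emeasure \<nu> {1<..} < \<infinity>"
  by (rule finite_away_from_zero[of _ 1]) auto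

lemma finite_left: "emeasure \<nu> {..<-1} < \<infinity>"
  by (rule finite_away_from_zero[of _ 1]) auto

text \<open>The compensator vanishes outside \<open>{-1..1}\<close>, so large jumps contribute plain
  compound Poisson exponents. The three terms belong to the three factors in
  \<open>ex_light_factor\<close>.\<close>

lemma integral_levy_integrand_split:
  "(LINT x|\<nu>. levy_integrand z x) = (LINT x:{1<..}|\<nu>. iexp (z * x) - 1) +
    (LINT x:{..<-1}|\<nu>. iexp (z * x) - 1) + (LINT x:{-1..1}|\<nu>. levy_integrand z x)"
proof -
  have "(LINT x|\<nu>. levy_integrand z x) = (LINT x|\<nu>. indicator {1<..} x *\<^sub>R levy_integrand z x +
      indicator {..<-1} x *\<^sub>R levy_integrand z x + indicator {-1..1} x *\<^sub>R levy_integrand z x)"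
    by (intro Bochner_Integration.integral_cong refl) (auto split: split_indicator)
  also have "\<dots> = (LINT x:{1<..}|\<nu>. levy_integrand z x) + (LINT x:{..<-1}|\<nu>. levy_integrand z x) +
      (LINT x:{-1..1}|\<nu>. levy_integrand z x)"
    using set_integrable_levy_integrand[of _ z] unfolding set_lebesgue_integral_def set_integrable_def
    by (subst Bochner_Integration.integral_add, simp, simp)+ simp
  also have "(LINT x:{1<..}|\<nu>. levy_integrand z x) = (LINT x:{1<..}|\<nu>. iexp (z * x) - 1)"
    by (intro set_lebesgue_integral_cong) (auto simp: levy_integrand_def)
  also have "(LINT x:{..<-1}|\<nu>. levy_integrand z x) = (LINT x:{..<-1}|\<nu>. iexp (z * x) - 1)"
    by (intro set_lebesgue_integral_cong) (auto simp: levy_integrand_def)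
  finally show ?thesis .
qed

text \<open>Continuity makes the Levy exponent the distinguished logarithm required by
  \<open>is_conv_rpower\<close>.\<close>

lemma continuous_on_integral_levy_integrand:
  "continuous_on UNIV (\<lambda>z. LINT x|\<nu>. levy_integrand z x)"
proof (intro continuous_at_imp_continuous_on ballI continuous_at_sequentiallyI)
  fix z :: real and u :: "nat \<Rightarrow> real" assume u: "u \<longlonglongrightarrow> z"
  then obtain B where B: "\<And>n. \<bar>u n\<bar> \<le> B"
    using Bseq_def convergent_imp_Bseq convergentI[OF u] by (metis real_norm_def)
  show "(\<lambda>n. LINT x|\<nu>. levy_integrand (u n) x) \<longlonglongrightarrow> (LINT x|\<nu>. levy_integrand z x)"
  proof (rule integral_dominated_convergence[where w="\<lambda>x. (2 + B\<^sup>2) * min 1 (x\<^sup>2)"])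
    show "AE x in \<nu>. (\<lambda>n. levy_integrand (u n) x) \<longlonglongrightarrow> levy_integrand z x"
      unfolding levy_integrand_def by (intro AE_I2 tendsto_intros u)
    show "AE x in \<nu>. norm (levy_integrand (u n) x) \<le> (2 + B\<^sup>2) * min 1 (x\<^sup>2)" for n
    proof (intro AE_I2 order_trans[OF norm_levy_integrand_le] mult_right_mono)
      show "2 + (u n)\<^sup>2 \<le> 2 + B\<^sup>2" using B[of n] by (simp add: abs_le_square_iff[symmetric])
    qed auto
  qed (use integrable_min in auto)
qed

text \<open>Limit of laws with finite jump intensity: keep the jumps in \<open>S n\<close>, bounded
  away from 0, and correct the mean by their compensator. The exponents converge by dominated
  convergence, and the exponential moments stay bounded because the compensated exponential is of
  second order in the jump size.\<close>

lemma ex_small_jump_law: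
  assumes t: "t > 0" and A: "A \<ge> 0"
  shows "\<exists>Q. light_tailed Q \<and> (\<forall>z. char Q z = exp (of_real t * (complex_of_real (- A * z\<^sup>2 / 2) +
    \<i> * complex_of_real (b * z) + (LINT x:{-1..1}|\<nu>. levy_integrand z x))))"
proof -
  define S where "S n = {x. 1 / real (Suc n) < \<bar>x\<bar> \<and> \<bar>x\<bar> \<le> 1}" for n
  have S [measurable]: "S n \<in> sets borel" for n unfolding S_def by measurable
  have finS: "emeasure \<nu> (S n) < \<infinity>" for n
    by (rule finite_away_from_zero[OF S, of "1 / real (Suc n)"]) (auto simp: S_def)
  note intS = set_integrable_bounded[OF sets_nu S finS]
  \<comment> \<open>Compensator of the retained jumps. It may diverge with \<open>n\<close>, so it
    is put into the mean of the normal factor and estimated only together with the jumps.\<close>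
  define \<beta> where "\<beta> n = (LINT x:S n|\<nu>. x)" for n
  define P where "P n = (normal_law (t * (b - \<beta> n)) (sqrt (t * A)) \<star> jump_law \<nu> (S n) t)" for n
  note rd = real_distribution_normal_law real_distribution_jump_law[OF sets_nu S finS t]
  have int_id: "set_integrable \<nu> (S n) (\<lambda>x. x)" for n
    by (rule intS[where B=1]) (auto simp: S_def)
  have char_P: "char (P n) z = exp (of_real t * (complex_of_real (- A * z\<^sup>2 / 2) +
    \<i> * complex_of_real (b * z) + (LINT x:S n|\<nu>. levy_integrand z x)))" for n z
  proof -
    have "(LINT x:S n|\<nu>. levy_integrand z x) = (LINT x:S n|\<nu>. (iexp (z * x) - 1) - \<i> * of_real z * complex_of_real x)"
      by (intro set_lebesgue_integral_cong) (auto simp: levy_integrand_def S_def abs_le_iff mult.assoc)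
    also have "\<dots> = (LINT x:S n|\<nu>. iexp (z * x) - 1) - (LINT x:S n|\<nu>. \<i> * of_real z * complex_of_real x)"
    proof (rule set_integral_diff(2))
      show "set_integrable \<nu> (S n) (\<lambda>x. iexp (z * x) - 1)"
        by (rule intS[where B=2]) (auto intro!: order_trans[OF norm_triangle_ineq4])
      show "set_integrable \<nu> (S n) (\<lambda>x. \<i> * of_real z * complex_of_real x)"
        by (rule intS[where B="\<bar>z\<bar>"]) (auto simp: S_def norm_mult mult_left_le)
    qed
    also have "(LINT x:S n|\<nu>. \<i> * of_real z * complex_of_real x) = \<i> * of_real z * of_real (\<beta> n)"
      by (simp add: \<beta>_def set_integral_complex_of_real)
    finally have eq: "(LINT x:S n|\<nu>. iexp (z * x) - 1) = (LINT x:S n|\<nu>. levy_integrand z x) + \<i> * of_real z * of_real (\<beta> n)"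
      by simp
    have sq: "(sqrt (t * A) * z)\<^sup>2 = t * A * z\<^sup>2" using t A by (simp add: power_mult_distrib)
    show ?thesis
      unfolding P_def char_convolution[OF rd] char_normal_law char_jump_law[OF sets_nu S finS t] eq sq
        exp_add[symmetric]
      by (simp add: algebra_simps)
  qed
  have lim: "(\<lambda>n. LINT x:S n|\<nu>. levy_integrand z x) \<longlonglongrightarrow> (LINT x:{-1..1}|\<nu>. levy_integrand z x)" for z
    unfolding set_lebesgue_integral_def
  proof (rule integral_dominated_convergence[where w="\<lambda>x. (2 + z\<^sup>2) * min 1 (x\<^sup>2)"])
    \<comment> \<open>Every nonzero point of \<open>{-1..1}\<close> eventually lies in
      \<open>S n\<close>, and at 0 the integrand vanishes.\<close>
    have "(\<lambda>n. indicator (S n) x *\<^sub>R levy_integrand z x) \<longlonglongrightarrow> indicator {-1..1} x *\<^sub>R levy_integrand z x" for x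
    proof (cases "x = 0")
      case True
      then show ?thesis by (simp add: levy_integrand_def)
    next
      case False
      have "(\<lambda>n. 1 / real (Suc n)) \<longlonglongrightarrow> 0" using LIMSEQ_inverse_real_of_nat by (simp add: inverse_eq_divide)
      then have "\<forall>\<^sub>F n in sequentially. 1 / real (Suc n) < \<bar>x\<bar>"
        by (rule order_tendstoD(2)) (use False in simp)
      then have "\<forall>\<^sub>F n in sequentially. indicator {-1..1} x *\<^sub>R levy_integrand z x = indicator (S n) x *\<^sub>R levy_integrand z x"
        by eventually_elim (auto simp: S_def split: split_indicator)
      then show ?thesis by (rule Lim_transform_eventually[OF tendsto_const])
    qed
    then show "AE x in \<nu>. (\<lambda>n. indicator (S n) x *\<^sub>R levy_integrand z x) \<longlonglongrightarrow> indicator {-1..1} x *\<^sub>R levy_integrand z x"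
      by simp
    show "AE x in \<nu>. norm (indicator (S n) x *\<^sub>R levy_integrand z x) \<le> (2 + z\<^sup>2) * min 1 (x\<^sup>2)" for n
      using norm_levy_integrand_le[of z] by (auto split: split_indicator)
  qed (use integrable_min in auto)
  define I where "I = (LINT x|\<nu>. min 1 (x\<^sup>2))"
  have mom: "(\<integral>\<^sup>+x. ennreal (exp (c * x)) \<partial>P n) \<le> ennreal (exp (t * (c * b + c\<^sup>2 * A / 2 + c\<^sup>2 * exp \<bar>c\<bar> * I)))" for c n
  proof -
    have B: "exp (c * x) \<le> exp \<bar>c\<bar>" if "x \<in> S n" for x
    proof -
      have "\<bar>c * x\<bar> \<le> \<bar>c\<bar> * 1" using that unfolding abs_mult by (intro mult_left_mono) (auto simp: S_def)
      then show ?thesis by simp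
    qed
    have i1: "set_integrable \<nu> (S n) (\<lambda>x. exp (c * x) - 1)"
      using B by (intro intS[where B="exp \<bar>c\<bar> + 1"]) (auto intro!: order_trans[OF abs_triangle_ineq4])
    have "(LINT x:S n|\<nu>. exp (c * x) - 1) - c * \<beta> n = (LINT x:S n|\<nu>. (exp (c * x) - 1) - c * x)"
      unfolding \<beta>_def using i1 int_id by (subst set_integral_diff(2)) auto
    also have "\<dots> \<le> (LINT x|\<nu>. c\<^sup>2 * exp \<bar>c\<bar> * min 1 (x\<^sup>2))"
      unfolding set_lebesgue_integral_def
    proof (rule integral_mono)
      show "integrable \<nu> (\<lambda>x. indicator (S n) x *\<^sub>R ((exp (c * x) - 1) - c * x))"
        using set_integral_diff(1)[OF i1 set_integrable_mult_right[of c, OF int_id]] by (simp add: set_integrable_def)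
      show "integrable \<nu> (\<lambda>x. c\<^sup>2 * exp \<bar>c\<bar> * min 1 (x\<^sup>2))" using integrable_min by simp
      fix x
      show "indicator (S n) x *\<^sub>R ((exp (c * x) - 1) - c * x) \<le> c\<^sup>2 * exp \<bar>c\<bar> * min 1 (x\<^sup>2)"
      proof (cases "x \<in> S n")
        case True
        have "(exp (c * x) - 1) - c * x \<le> (c * x)\<^sup>2 * exp \<bar>c * x\<bar>" using exp_remainder_le[of "c * x"] by linarith
        also have "\<dots> \<le> (c * x)\<^sup>2 * exp \<bar>c\<bar>"
          using True unfolding abs_mult by (intro mult_left_mono) (auto simp: S_def mult_left_le)
        also have "\<dots> = c\<^sup>2 * exp \<bar>c\<bar> * min 1 (x\<^sup>2)"
          using True by (simp add: S_def power_mult_distrib min_absorb2 abs_square_le_1)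
        finally show ?thesis using True by simp
      qed simp
    qed
    also have "\<dots> = c\<^sup>2 * exp \<bar>c\<bar> * I" by (simp add: I_def)
    finally have le: "(LINT x:S n|\<nu>. exp (c * x) - 1) - c * \<beta> n \<le> c\<^sup>2 * exp \<bar>c\<bar> * I" .
    have sq: "(c * sqrt (t * A))\<^sup>2 = c\<^sup>2 * (t * A)" using t A by (simp add: power_mult_distrib)
    have "(\<integral>\<^sup>+x. ennreal (exp (c * x)) \<partial>P n) =
        ennreal (exp (c * (t * (b - \<beta> n)) + c\<^sup>2 * (t * A) / 2)) * ennreal (exp (t * (LINT x:S n|\<nu>. exp (c * x) - 1)))"
      unfolding P_def nn_integral_exp_convolution[OF rd] nn_integral_exp_normal_law sq
      using nn_integral_exp_jump_law[OF sets_nu S finS t B] by simp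
    also have "\<dots> = ennreal (exp (t * (c * b + c\<^sup>2 * A / 2 + ((LINT x:S n|\<nu>. exp (c * x) - 1) - c * \<beta> n))))"
      by (simp add: algebra_simps flip: ennreal_mult exp_add)
    also have "\<dots> \<le> ennreal (exp (t * (c * b + c\<^sup>2 * A / 2 + c\<^sup>2 * exp \<bar>c\<bar> * I)))"
      using le t by (intro ennreal_leI) simp
    finally show ?thesis .
  qed
  show ?thesis
  proof (rule exp_moment_limit[of P])
    show "real_distribution (P n)" for n unfolding P_def by (intro real_distribution_convolution rd)
    show "\<exists>K. \<forall>n. (\<integral>\<^sup>+x. ennreal (exp (c * x)) \<partial>P n) \<le> ennreal K" for c using mom by blast
    show "(\<lambda>n. char (P n) z) \<longlonglongrightarrow> exp (of_real t * (complex_of_real (- A * z\<^sup>2 / 2) +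
      \<i> * complex_of_real (b * z) + (LINT x:{-1..1}|\<nu>. levy_integrand z x)))" for z
      unfolding char_P by (intro tendsto_intros lim)
  qed
qed

text \<open>For \<open>c > 0\<close> the function \<open>exp (c * x)\<close> is bounded on negative
  jumps, however heavy the left tail; this is why \<open>light_tailed\<close> is one-sided.\<close>

lemma light_tailed_negative_jump_law:
  assumes t: "t > 0"
  shows "light_tailed (jump_law \<nu> {..<-1} t)"
proof -
  have rd: "real_distribution (jump_law \<nu> {..<-1} t)"
    by (rule real_distribution_jump_law[OF sets_nu _ finite_left t]) simp
  have "(\<integral>\<^sup>+x. ennreal (exp (c * x)) \<partial>jump_law \<nu> {..<-1} t) < \<infinity>" if "c > 0" for c
  proof -
    have "exp (c * x) \<le> 1" if "x \<in> {..<-1}" for x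
      using that \<open>c > 0\<close> by (auto simp: mult_le_0_iff)
    then show ?thesis
      by (subst nn_integral_exp_jump_law[OF sets_nu _ finite_left t, where B=1]) auto
  qed
  then show ?thesis unfolding light_tailed_def using rd by (simp add: integrable_exp_iff)
qed

lemma ex_light_factor:
  assumes "t > 0" "A \<ge> 0"
  shows "\<exists>Z. light_tailed Z \<and> (\<forall>z. char (jump_law \<nu> {1<..} t \<star> Z) z = exp (of_real t *
    (complex_of_real (- A * z\<^sup>2 / 2) + \<i> * complex_of_real (b * z) + (LINT x|\<nu>. levy_integrand z x))))"
proof -
  obtain Q where Q: "light_tailed Q" "\<And>z. char Q z = exp (of_real t * (complex_of_real (- A * z\<^sup>2 / 2) +
    \<i> * complex_of_real (b * z) + (LINT x:{-1..1}|\<nu>. levy_integrand z x)))"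
    using ex_small_jump_law[OF assms] by blast
  let ?N = "jump_law \<nu> {..<-1} t" and ?C = "jump_law \<nu> {1<..} t"
  have rdQ: "real_distribution Q" using Q by (simp add: light_tailed_def)
  have rdN: "real_distribution ?N"
    by (rule real_distribution_jump_law[OF sets_nu _ finite_left assms(1)]) simp
  have rdC: "real_distribution ?C"
    by (rule real_distribution_jump_law[OF sets_nu _ finite_right assms(1)]) simp
  have "char (?C \<star> (?N \<star> Q)) z = exp (of_real t *
    (complex_of_real (- A * z\<^sup>2 / 2) + \<i> * complex_of_real (b * z) + (LINT x|\<nu>. levy_integrand z x)))" for z
    unfolding char_convolution[OF rdC real_distribution_convolution[OF rdN rdQ]]
      char_convolution[OF rdN rdQ] Q integral_levy_integrand_split
      char_jump_law[OF sets_nu greaterThan_borel finite_right assms(1)]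
      char_jump_law[OF sets_nu lessThan_borel finite_left assms(1)] exp_add[symmetric]
    by (simp add: algebra_simps)
  then show ?thesis
    using light_tailed_convolution[OF light_tailed_negative_jump_law[OF assms(1)] Q(1)] by blast
qed

end

section \<open>Distinguished logarithms and real convolution powers\<close>

text \<open>The difference takes values in the integer multiples of \<open>2 * pi * \<i>\<close>;
  being continuous on a connected set, it is constant.\<close>

lemma distinguished_log_unique:
  fixes f g :: "real \<Rightarrow> complex"
  assumes "continuous_on UNIV f" "continuous_on UNIV g" "f 0 = g 0" "\<And>z. exp (f z) = exp (g z)"
  shows "f = g"
proof -
  have per: "\<exists>n::int. f z - g z = of_int (2 * n) * of_real pi * \<i>" for z
  proof -
    have "exp (f z - g z) = 1" by (simp add: exp_diff assms(4))
    then obtain n :: int where "Re (f z - g z) = 0" "Im (f z - g z) = of_int (2 * n) * pi"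
      by (auto simp: exp_eq_1)
    then show ?thesis by (intro exI[of _ n]) (simp add: complex_eq_iff)
  qed
  have "(\<lambda>z. f z - g z) constant_on UNIV"
  proof (rule continuous_discrete_range_constant)
    show "connected (UNIV :: real set)" by (rule connected_UNIV)
    show "continuous_on UNIV (\<lambda>z. f z - g z)" by (intro continuous_intros assms)
    fix x :: real
    show "\<exists>e>0. \<forall>y. y \<in> UNIV \<and> (f y - g y) \<noteq> (f x - g x) \<longrightarrow> e \<le> norm ((f y - g y) - (f x - g x))"
    \<comment> \<open>Distinct values differ by at least \<open>2 * pi\<close>, so \<open>1\<close>
      serves as the gap.\<close>
    proof (intro exI[of _ 1] conjI allI impI; (elim conjE)?)
      fix y assume ne: "f y - g y \<noteq> f x - g x"
      obtain n m :: int where nm: "f y - g y = of_int (2 * n) * of_real pi * \<i>" "f x - g x = of_int (2 * m) * of_real pi * \<i>"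
        using per by meson
      then have "n \<noteq> m" using ne by auto
      then have "1 \<le> \<bar>real_of_int (n - m)\<bar>" by linarith
      have "(f y - g y) - (f x - g x) = of_real (real_of_int (n - m) * (2 * pi)) * \<i>"
        unfolding nm by (simp add: algebra_simps)
      then have "norm ((f y - g y) - (f x - g x)) = \<bar>real_of_int (n - m)\<bar> * (2 * pi)"
        by (simp only: norm_mult norm_of_real norm_ii) (simp add: abs_mult)
      also have "\<dots> \<ge> 1 * 1" using \<open>1 \<le> \<bar>real_of_int (n - m)\<bar>\<close> pi_gt3 by (intro mult_mono) auto
      finally show "1 \<le> norm ((f y - g y) - (f x - g x))" by simp
    qed simp
  qed
  then have "f z - g z = f 0 - g 0" for z by (auto simp: constant_on_def)
  then show ?thesis using assms(3) by auto
qed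

text \<open>Resolves the definite description in \<open>conv_rpower\<close>: the logarithm is
  unique, and the law is determined by its characteristic function.\<close>

lemma conv_rpower_eqI:
  assumes "real_distribution \<rho>" "continuous_on UNIV \<psi>" "\<psi> 0 = 0"
    and "\<And>z. char \<mu> z = exp (\<psi> z)" "\<And>z. char \<rho> z = exp (complex_of_real t * \<psi> z)"
  shows "conv_rpower \<mu> t = \<rho>"
  unfolding conv_rpower_def
proof (rule the_equality)
  show "is_conv_rpower \<mu> t \<rho>" unfolding is_conv_rpower_def using assms by blast
  fix \<rho>' assume "is_conv_rpower \<mu> t \<rho>'"
  then obtain \<psi>' where \<psi>': "real_distribution \<rho>'" "continuous_on UNIV \<psi>'" "\<psi>' 0 = 0"
    "\<And>z. char \<mu> z = exp (\<psi>' z)" "\<And>z. char \<rho>' z = exp (complex_of_real t * \<psi>' z)"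
    unfolding is_conv_rpower_def by blast
  have "\<psi>' = \<psi>" using distinguished_log_unique[of \<psi>' \<psi>] \<psi>' assms by simp
  then show "\<rho>' = \<rho>" using \<psi>' assms by (intro Levy_uniqueness) (auto simp: fun_eq_iff)
qed

subsection \<open>The dichotomy\<close>

lemma class_OS_imp_convolution_dominating:
  assumes "\<mu> \<in> class_OS" "\<gamma> > 0"
  shows "convolution_dominating \<mu> \<gamma>"
  unfolding convolution_dominating_def
proof (intro conjI allI)
  show rd: "real_distribution \<mu>" and "\<gamma> > 0" using assms by (auto simp: class_OS_def)
  show pos: "0 < tail \<mu> x" for x
  proof -
    have "0 < tail \<mu> (max 1 x)" using assms(1) by (simp add: class_OS_def)
    also have "\<dots> \<le> tail \<mu> x" by (rule tail_antimono[OF rd]) simp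
    finally show ?thesis .
  qed
  have cp2: "conv_power \<mu> 2 = (\<mu> \<star> \<mu>)"
    by (rule Levy_uniqueness)
       (auto simp: fun_eq_iff char_conv_power char_convolution rd real_distribution_conv_power
         real_distribution_convolution power2_eq_square)
  have "Limsup at_top (\<lambda>x. ereal (tail (\<mu> \<star> \<mu>) x / tail \<mu> x)) < \<infinity>"
    using assms(1) by (simp add: class_OS_def asymp_comparable_def cp2)
  then obtain K :: real where "Limsup at_top (\<lambda>x. ereal (tail (\<mu> \<star> \<mu>) x / tail \<mu> x)) < ereal K"
    using less_PInf_Ex_of_nat by (metis ereal_dense2)
  then have "\<forall>\<^sub>F x in at_top. ereal (tail (\<mu> \<star> \<mu>) x / tail \<mu> x) < ereal K"
    by (rule Limsup_lessD)
  then obtain x0 where x0: "\<And>x. x \<ge> x0 \<Longrightarrow> tail (\<mu> \<star> \<mu>) x / tail \<mu> x < K"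
    by (auto simp: eventually_at_top_linorder)
  have "tail (\<mu> \<star> \<mu>) x \<le> max K (1 / tail \<mu> x0) * tail \<mu> x" for x
  proof (cases "x \<ge> x0")
    case True
    then have "tail (\<mu> \<star> \<mu>) x \<le> K * tail \<mu> x" using x0[OF True] pos[of x] by (simp add: field_simps)
    also have "\<dots> \<le> max K (1 / tail \<mu> x0) * tail \<mu> x" using pos[of x] by (intro mult_right_mono) auto
    finally show ?thesis .
  next
    case False
    \<comment> \<open>Left of \<open>x0\<close> the tail of \<open>\<mu>\<close> is at least
      \<open>tail \<mu> x0\<close>, so the trivial bound 1 extends the estimate to the whole
      line.\<close>
    have "tail (\<mu> \<star> \<mu>) x \<le> 1 / tail \<mu> x0 * tail \<mu> x0"
      using tail_bounds[OF real_distribution_convolution[OF rd rd]] pos[of x0] by simp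
    also have "\<dots> \<le> max K (1 / tail \<mu> x0) * tail \<mu> x"
      using False pos[of x0] by (intro mult_mono tail_antimono rd) (auto simp: le_max_iff_disj)
    finally show ?thesis .
  qed
  then show "\<exists>K. \<forall>x. tail (\<mu> \<star> \<mu>) x \<le> K * tail \<mu> x" by blast
qed

theorem proposition1p1:
  fixes \<gamma> :: real and \<mu> \<nu> :: "real measure"
  assumes "\<gamma> > 0"
    and "\<mu> \<in> class_OS \<inter> class_ID"
    and "is_levy_measure \<mu> \<nu>"
    and "\<forall>a\<ge>0. Liminf at_top (\<lambda>x. ereal
           (exp (- \<gamma> * a) * tail (levy_tail_measure \<nu>) (x - a) / tail (levy_tail_measure \<nu>) x)) \<ge> 1"
  shows "T_set \<mu> \<gamma> = {0<..} \<or> T_set \<mu> \<gamma> = {}"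
proof -
  let ?\<tau> = "tail (levy_tail_measure \<nu>)"
  interpret L: levy_measure \<nu>
    using assms(3) by unfold_locales (auto simp: is_levy_measure_def)
  obtain A b where A: "A \<ge> 0" and char_mu: "\<And>z. char \<mu> z = exp (complex_of_real (- A * z\<^sup>2 / 2) +
      \<i> * complex_of_real (b * z) + (LINT x|\<nu>. levy_integrand z x))"
    using assms(3) unfolding is_levy_measure_def levy_integrand_def by blast
  define \<psi> where "\<psi> z = complex_of_real (- A * z\<^sup>2 / 2) + \<i> * complex_of_real (b * z) +
      (LINT x|\<nu>. levy_integrand z x)" for z
  have \<psi>_cont: "continuous_on UNIV \<psi>"
    unfolding \<psi>_def[abs_def] by (intro continuous_intros L.continuous_on_integral_levy_integrand) auto
  have \<psi>_0: "\<psi> 0 = 0" by (simp add: \<psi>_def levy_integrand_def)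

  have ratio: "\<forall>\<^sub>F x in at_top. c < exp (- \<gamma> * a) * ?\<tau> (x - a) / ?\<tau> x" if "a \<ge> 0" "c < 1" for a c
  proof -
    have "ereal c < 1" using that(2) by (simp add: one_ereal_def)
    then have "\<forall>\<^sub>F x in at_top. ereal c < ereal (exp (- \<gamma> * a) * ?\<tau> (x - a) / ?\<tau> x)"
      using assms(4) that(1) unfolding le_Liminf_iff by blast
    then show ?thesis by simp
  qed
  define r where "r = measure \<nu> {1<..}"
  \<comment> \<open>Without jumps above 1 all tails of \<open>levy_tail_measure \<nu>\<close> would
    be 0, and every quotient in the hypothesis would be \<open>0 / 0 = 0\<close>, against a lower
    limit of at least 1.\<close>
  have "r \<noteq> 0"
  proof
    assume "r = 0"
    then have "emeasure \<nu> {1<..} = 0"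
      using L.finite_right by (auto simp: r_def measure_def enn2real_eq_0_iff)
    then have "?\<tau> x = 0" for x
    proof -
      have "emeasure \<nu> ({1<..} \<inter> {x<..}) \<le> emeasure \<nu> {1<..}" by (intro emeasure_mono) auto
      then have "emeasure \<nu> ({1<..} \<inter> {x<..}) = 0" using \<open>emeasure \<nu> {1<..} = 0\<close> by simp
      then show ?thesis by (simp add: tail_def levy_tail_measure_def measure_def)
    qed
    then show False using ratio[of 0 "1/2"] by simp
  qed
  then have r: "r > 0" by (simp add: r_def zero_less_measure_iff)

  define CP where "CP = jump_law \<nu> {1<..}"
  \<comment> \<open>Chosen for each \<open>t\<close> separately; the semigroup law of
    \<open>M\<close> is read off from the characteristic functions.\<close>
  define Z where "Z t = (SOME Z. light_tailed Z \<and> (\<forall>z. char (CP t \<star> Z) z = exp (of_real t * \<psi> z)))" for t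
  have Z: "light_tailed (Z t)" "char (CP t \<star> Z t) z = exp (of_real t * \<psi> z)" if "t > 0" for t z
    using someI_ex[OF L.ex_light_factor[OF that A, of b]] unfolding Z_def CP_def \<psi>_def by auto
  define M where "M t = (CP t \<star> Z t)" for t
  have rd_CP: "real_distribution (CP t)" if "t > 0" for t
    unfolding CP_def by (rule real_distribution_jump_law[OF L.sets_nu _ L.finite_right that]) simp
  have rd_M: "real_distribution (M t)" if "t > 0" for t
    using Z(1)[OF that] rd_CP[OF that] unfolding M_def light_tailed_def
    by (simp add: real_distribution_convolution)
  have char_M: "char (M t) z = exp (of_real t * \<psi> z)" if "t > 0" for t z
    unfolding M_def by (rule Z(2)[OF that])
  have rpower: "conv_rpower \<mu> t = M t" if "t > 0" for t
    by (rule conv_rpower_eqI[OF rd_M[OF that] \<psi>_cont \<psi>_0]) (simp_all add: char_M that char_mu \<psi>_def)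
  interpret C: convolution_dominating \<mu> \<gamma>
    using assms(1,2) class_OS_imp_convolution_dominating by blast
  have rd_rho: "real_distribution (levy_tail_measure \<nu>)"
    unfolding levy_tail_measure_def
    by (rule real_distribution_uniform[OF L.sets_nu _ L.finite_right]) (use r in \<open>auto simp: r_def\<close>)
  have CP: "CP t = compound_poisson (t * r) (levy_tail_measure \<nu>)" for t
    using r by (simp add: CP_def jump_law_def levy_tail_measure_def r_def)
  interpret F: levy_factorisation \<mu> \<gamma> M CP Z "levy_tail_measure \<nu>" r
  proof (rule levy_factorisation.intro[OF C.convolution_dominating_axioms],
      rule levy_factorisation_axioms.intro)
    show "M 1 = \<mu>"
      using rd_M[of 1] C.real_distribution_mu
      by (intro Levy_uniqueness) (auto simp: fun_eq_iff char_M char_mu \<psi>_def)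
    show "M (s + t) = (M s \<star> M t)" if "s > 0" "t > 0" for s t
      using that rd_M
      by (intro Levy_uniqueness real_distribution_convolution)
         (auto simp: fun_eq_iff char_convolution char_M ring_distribs exp_add)
    show "(\<lambda>n. exp (- (r * t)) * (r * t) ^ n / fact n * tail (conv_power (levy_tail_measure \<nu>) n) x) sums tail (CP t) x"
      if "t > 0" for t x
      unfolding CP mult.commute[of t r]
      by (rule tail_compound_poisson_sums) (use that r rd_rho in auto)
    show "\<forall>\<^sub>F x in at_top. (1 - \<epsilon>) * ?\<tau> x \<le> exp (- \<gamma> * a) * ?\<tau> (x - a)" if "a \<ge> 0" "\<epsilon> > 0" for a \<epsilon>
    proof (cases "\<epsilon> < 1")
      case True
      have "\<forall>\<^sub>F x in at_top. 1 - \<epsilon> < exp (- \<gamma> * a) * ?\<tau> (x - a) / ?\<tau> x"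
        using that by (intro ratio) auto
      then show ?thesis
      proof eventually_elim
        case (elim x)
        \<comment> \<open>A zero denominator would make the quotient 0, which the lower bound
          \<open>1 - \<epsilon> > 0\<close> excludes.\<close>
        have "?\<tau> x \<noteq> 0" using elim True by auto
        then have "?\<tau> x > 0" using tail_bounds[OF rd_rho, of x] by simp
        then show ?case using elim by (simp add: field_simps)
      qed
    next
      case False
      have "(1 - \<epsilon>) * ?\<tau> x \<le> exp (- \<gamma> * a) * ?\<tau> (x - a)" for x
      proof -
        have "(1 - \<epsilon>) * ?\<tau> x \<le> 0"
          using False by (intro mult_nonpos_nonneg tail_bounds(1)[OF rd_rho]) simp
        also have "0 \<le> exp (- \<gamma> * a) * ?\<tau> (x - a)"
          by (intro mult_nonneg_nonneg exp_ge_zero tail_bounds(1)[OF rd_rho])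
        finally show ?thesis .
      qed
      then show ?thesis by (intro always_eventually allI)
    qed
    show "M t = (CP t \<star> Z t)" for t by (rule M_def)
  qed (fact r rd_rho | erule rd_CP Z(1))+
  show ?thesis
  proof (cases "T_set \<mu> \<gamma> = {}")
    case False
    then obtain t0 where t0: "t0 > 0" "M t0 \<in> class_L \<gamma>" unfolding T_set_def using rpower by force
    have "t \<in> T_set \<mu> \<gamma> \<longleftrightarrow> t > 0" for t
      using F.class_L_dichotomy[OF t0, of t] rpower[of t] unfolding T_set_def by auto
    then have "T_set \<mu> \<gamma> = {0<..}" by blast
    then show ?thesis ..
  qed simp
qed

end
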